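(* Let $P$ be a finite poset of width $2$ and let $\kappa_2(P)$ denote the number of connected components of $\overline{G}(P)$ that have exactly $2$ vertices. Then $$|P|\cdot \overline{H}(P) \leqslant (2-\varepsilon)\log e(P) + \varepsilon\,\kappa_2(P), \qquad \text{where } \varepsilon = 2 - \frac{3\log 3 - 2}{\log 3}\ (\approx 0.26).$$
   Context: All logarithms are base $2$. For a finite simple graph $G=(V,E)$ with $n=|V|$ vertices, $\mathrm{STAB}(G)\subseteq\mathbb{R}^V$ is the convex hull of the characteristic vectors of the stable sets of $G$. The entropy of $G$ is $$H(G)=\min_{x\in \mathrm{STAB}(G),\,x>0} -\frac1n\sum_{v\in V}\log x_v.$$ For a finite poset $P$: - $\overline{G}(P)$ is its incomparability graph, whose vertices are the elements of $P$ and whose edges join distinct incomparable elements; - $\overline{H}(P):=H(\overline{G}(P))$; - $e(P)$ is the number of linear extensions of $P$; - the width of $P$ is the size of a largest antichain of $P$. *)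

theory Defs
  imports "HOL-Analysis.Analysis" "HOL-Library.Function_Algebras"
begin

text \<open>Pointwise vector space structure on functions, so that convex hulls in \<open>\<real>\<^sup>V\<close> are
  available for a vertex set \<open>V\<close> of arbitrary type.\<close>

instantiation "fun" :: (type, real_vector) real_vector
begin

definition scaleR_fun :: "real \<Rightarrow> ('a \<Rightarrow> 'b) \<Rightarrow> 'a \<Rightarrow> 'b"
  where "scaleR_fun c f = (\<lambda>x. c *\<^sub>R f x)"

instance
  by standard (auto simp: scaleR_fun_def fun_eq_iff plus_fun_def scaleR_add_right scaleR_add_left)

end

lemma scaleR_fun_apply [simp]: "(c *\<^sub>R f) x = c *\<^sub>R f x"
  for f :: "'a \<Rightarrow> 'b::real_vector"
  by (simp add: scaleR_fun_def)

lemma sum_fun_apply: "(\<Sum>i\<in>I. f i) x = (\<Sum>i\<in>I. f i x)"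
  for f :: "'i \<Rightarrow> 'a \<Rightarrow> 'b::comm_monoid_add"
  by (induction I rule: infinite_finite_induct) auto


section \<open>Graphs\<close>

text \<open>A graph is given by its vertex set \<open>V\<close> and its adjacency relation \<open>E\<close>, so each
  undirected edge \<open>uv\<close> is represented by both \<open>(u, v)\<close> and \<open>(v, u)\<close>.\<close>

definition finite_simple_graph :: "'a set \<Rightarrow> 'a rel \<Rightarrow> bool" where
  "finite_simple_graph V E \<longleftrightarrow> finite V \<and> E \<subseteq> V \<times> V \<and> sym E \<and> irrefl E"

definition stable_set :: "'a set \<Rightarrow> 'a rel \<Rightarrow> 'a set \<Rightarrow> bool" where
  "stable_set V E S \<longleftrightarrow> S \<subseteq> V \<and> (\<forall>u\<in>S. \<forall>v\<in>S. (u, v) \<notin> E)"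

text \<open>\<open>\<real>\<^sup>V\<close> is identified with the functions vanishing outside \<open>V\<close>.\<close>

definition STAB :: "'a set \<Rightarrow> 'a rel \<Rightarrow> ('a \<Rightarrow> real) set" where
  "STAB V E = convex hull (indicator ` {S. stable_set V E S})"

text \<open>The minimum over the positive points of \<open>STAB V E\<close>; it is attained for every finite simple
  graph, see \<open>graph_entropy_attained\<close> below.\<close>

definition graph_entropy :: "'a set \<Rightarrow> 'a rel \<Rightarrow> real" where
  "graph_entropy V E =
    (LEAST h. \<exists>x\<in>STAB V E. (\<forall>v\<in>V. x v > 0) \<and>
       h = - (1 / real (card V)) * (\<Sum>v\<in>V. log 2 (x v)))"

definition connected_components :: "'a set \<Rightarrow> 'a rel \<Rightarrow> 'a set set" where
  "connected_components V E = V // {(u, v). u \<in> V \<and> v \<in> V \<and> (u, v) \<in> E\<^sup>*}"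


section \<open>Posets\<close>

text \<open>A poset is given by its ground set \<open>A\<close> and a reflexive order relation \<open>r\<close> with
  \<open>partial_order_on A r\<close>.\<close>

definition incomparability :: "'a set \<Rightarrow> 'a rel \<Rightarrow> 'a rel" where
  "incomparability A r =
    {(u, v). u \<in> A \<and> v \<in> A \<and> u \<noteq> v \<and> (u, v) \<notin> r \<and> (v, u) \<notin> r}"

definition incomparability_entropy :: "'a set \<Rightarrow> 'a rel \<Rightarrow> real" where
  "incomparability_entropy A r = graph_entropy A (incomparability A r)"

definition linear_extensions :: "'a set \<Rightarrow> 'a rel \<Rightarrow> 'a rel set" where
  "linear_extensions A r = {s. linear_order_on A s \<and> r \<subseteq> s}"

definition antichain :: "'a set \<Rightarrow> 'a rel \<Rightarrow> 'a set \<Rightarrow> bool" where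
  "antichain A r S \<longleftrightarrow>
    S \<subseteq> A \<and> (\<forall>u\<in>S. \<forall>v\<in>S. u \<noteq> v \<longrightarrow> (u, v) \<notin> r \<and> (v, u) \<notin> r)"

definition width :: "'a set \<Rightarrow> 'a rel \<Rightarrow> nat" where
  "width A r = Max (card ` {S. antichain A r S})"

definition kappa2 :: "'a set \<Rightarrow> 'a rel \<Rightarrow> nat" where
  "kappa2 A r = card {C \<in> connected_components A (incomparability A r). card C = 2}"


section \<open>Well-definedness\<close>

lemma finite_simple_graph_incomparability:
  "finite A \<Longrightarrow> finite_simple_graph A (incomparability A r)"
  by (auto simp: finite_simple_graph_def incomparability_def sym_def irrefl_on_def)

lemma finite_linear_extensions: "finite A \<Longrightarrow> finite (linear_extensions A r)"
  by (rule finite_subset[of _ "Pow (A \<times> A)"])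
    (auto simp: linear_extensions_def order_on_defs)

lemma finite_antichains: "finite A \<Longrightarrow> finite {S. antichain A r S}"
  by (rule finite_subset[of _ "Pow A"]) (auto simp: antichain_def)

lemma finite_connected_components: "finite V \<Longrightarrow> finite (connected_components V E)"
  unfolding connected_components_def by (rule finite_quotient) auto

lemma finite_stable_sets: "finite V \<Longrightarrow> finite {S. stable_set V E S}"
  by (rule finite_subset[of _ "Pow V"]) (auto simp: stable_set_def)

lemma inj_indicator: "inj (indicator :: 'a set \<Rightarrow> 'a \<Rightarrow> real)"
  by (rule injI) (metis indicator_eq_1_iff set_eqI)

lemma STAB_eq:
  assumes "finite V"
  shows "STAB V E = {x. \<exists>u. (\<forall>S\<in>{S. stable_set V E S}. 0 \<le> u S) \<and> sum u {S. stable_set V E S} = 1 \<and>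
           x = (\<lambda>v. \<Sum>S | stable_set V E S. u S * indicator S v)}" (is "_ = ?R")
proof (intro equalityI subsetI)
  let ?T = "{S. stable_set V E S}"
  let ?I = "indicator :: 'a set \<Rightarrow> 'a \<Rightarrow> real"
  have fin: "finite ?T" using assms by (rule finite_stable_sets)
  have inj: "inj_on ?I ?T" using inj_indicator by (rule inj_on_subset) simp
  have hull: "STAB V E = {y. \<exists>u. (\<forall>x\<in>?I ` ?T. 0 \<le> u x) \<and> sum u (?I ` ?T) = 1 \<and>
      (\<Sum>x\<in>?I ` ?T. u x *\<^sub>R x) = y}"
    unfolding STAB_def by (rule convex_hull_finite) (use fin in simp)
  fix x
  {
    assume "x \<in> STAB V E"
    then obtain u where u: "\<forall>x\<in>?I ` ?T. 0 \<le> u x" "sum u (?I ` ?T) = 1"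
      "(\<Sum>x\<in>?I ` ?T. u x *\<^sub>R x) = x"
      unfolding hull by blast
    have "x = (\<lambda>v. \<Sum>S\<in>?T. u (?I S) * ?I S v)"
      using u(3) by (auto simp: fun_eq_iff sum.reindex[OF inj] sum_fun_apply)
    moreover have "sum (\<lambda>S. u (?I S)) ?T = 1"
      using u(2) by (simp add: sum.reindex[OF inj])
    ultimately show "x \<in> ?R"
      using u(1) by (intro CollectI exI[of _ "\<lambda>S. u (?I S)"]) auto
  next
    assume "x \<in> ?R"
    then obtain u where u: "\<forall>S\<in>?T. 0 \<le> u S" "sum u ?T = 1"
      "x = (\<lambda>v. \<Sum>S\<in>?T. u S * ?I S v)" by blast
    define w where "w = u \<circ> the_inv_into ?T ?I"
    have w: "w (?I S) = u S" if "S \<in> ?T" for S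
      using the_inv_into_f_f[OF inj that] by (simp add: w_def)
    have "sum w (?I ` ?T) = 1"
      using u(2) w by (simp add: sum.reindex[OF inj])
    moreover have "(\<Sum>y\<in>?I ` ?T. w y *\<^sub>R y) = x"
      using w by (auto simp: fun_eq_iff sum.reindex[OF inj] sum_fun_apply u(3) intro!: sum.cong)
    ultimately show "x \<in> STAB V E"
      unfolding hull using u(1) w by (intro CollectI exI[of _ w]) auto
  }
qed

lemma ex_pos_STAB:
  assumes "finite_simple_graph V E"
  shows "\<exists>x\<in>STAB V E. \<forall>v\<in>V. x v > 0"
proof -
  let ?T = "{S. stable_set V E S}"
  have fin: "finite V" using assms by (simp add: finite_simple_graph_def)
  then have finT: "finite ?T" by (rule finite_stable_sets)
  have "{} \<in> ?T" by (simp add: stable_set_def)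
  then have card: "real (card ?T) > 0" using finT by (auto simp: card_gt_0_iff)
  define u :: "'a set \<Rightarrow> real" where "u = (\<lambda>_. 1 / real (card ?T))"
  define x where "x = (\<lambda>v. \<Sum>S\<in>?T. u S * indicator S v)"
  have "x \<in> STAB V E"
    unfolding STAB_eq[OF fin] x_def
    using card by (intro CollectI exI[of _ u]) (auto simp: u_def)
  moreover have "x v > 0" if "v \<in> V" for v
  proof -
    have "{v} \<in> ?T"
      using assms that by (auto simp: stable_set_def finite_simple_graph_def irrefl_on_def)
    then have "u {v} * indicator {v} v \<le> x v"
      unfolding x_def using finT card by (intro member_le_sum) (auto simp: u_def)
    then show ?thesis using card by (auto simp: u_def intro: less_le_trans[rotated])
  qed
  ultimately show ?thesis by blast
qed

lemma graph_entropy_minimizer: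
  assumes "finite_simple_graph V E"
  shows "\<exists>x\<in>STAB V E. (\<forall>v\<in>V. x v > 0) \<and>
    (\<forall>y\<in>STAB V E. (\<forall>v\<in>V. y v > 0) \<longrightarrow>
      - (1 / real (card V)) * (\<Sum>v\<in>V. log 2 (x v)) \<le> - (1 / real (card V)) * (\<Sum>v\<in>V. log 2 (y v)))"
proof -
  let ?T = "{S. stable_set V E S}"
  have fin: "finite V" using assms by (simp add: finite_simple_graph_def)
  then have finT: "finite ?T" by (rule finite_stable_sets)
  define B :: "('a set \<Rightarrow> real) set"
    where "B = (\<Pi>\<^sub>E S\<in>UNIV. if S \<in> ?T then {0..1} else {0})"
  define K where "K = B \<inter> {u. sum u ?T = 1}"
  define pt :: "('a set \<Rightarrow> real) \<Rightarrow> 'a \<Rightarrow> real"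
    where "pt = (\<lambda>u v. \<Sum>S\<in>?T. u S * indicator S v)"
  have cont: "continuous_on UNIV (\<lambda>u :: 'a set \<Rightarrow> real. u S)" for S
    by (rule continuous_on_product_coordinates)
  have "compactin (product_topology (\<lambda>_::'a set. euclidean :: real topology) UNIV) B"
    unfolding B_def by (subst compactin_PiE) auto
  then have "compact B" by (simp add: euclidean_product_topology)
  moreover have "closed {u :: 'a set \<Rightarrow> real. sum u ?T = 1}"
    by (intro closed_Collect_eq continuous_on_sum cont continuous_on_const)
  ultimately have "compact K" unfolding K_def by (rule compact_Int_closed)
  have STAB_K: "STAB V E = pt ` K"
  proof (intro equalityI subsetI)
    fix x assume "x \<in> STAB V E"
    then obtain u where u: "\<forall>S\<in>?T. 0 \<le> u S" "sum u ?T = 1" "x = pt u"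
      unfolding STAB_eq[OF fin] pt_def by blast
    define w where "w = (\<lambda>S. if S \<in> ?T then u S else 0)"
    have "u S \<le> 1" if "S \<in> ?T" for S
      using member_le_sum[of S ?T u] that u finT by auto
    then have "w \<in> B" using u by (auto simp: B_def w_def)
    moreover have "sum w ?T = 1" using u(2) by (simp add: w_def)
    moreover have "pt w = x" by (auto simp: u(3) pt_def w_def fun_eq_iff intro!: sum.cong)
    ultimately show "x \<in> pt ` K" by (auto simp: K_def)
  next
    fix x assume "x \<in> pt ` K"
    then obtain u where u: "u \<in> B" "sum u ?T = 1" "x = pt u" by (auto simp: K_def)
    have "\<forall>S\<in>?T. 0 \<le> u S"
    proof
      fix S assume "S \<in> ?T"
      moreover have "u S \<in> (if S \<in> ?T then {0..1} else {0})"
        using u(1) unfolding B_def by (rule PiE_mem) simp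
      ultimately show "0 \<le> u S" by simp
    qed
    then show "x \<in> STAB V E" unfolding STAB_eq[OF fin] using u by (auto simp: pt_def)
  qed
  obtain x0 where x0: "x0 \<in> STAB V E" "\<forall>v\<in>V. x0 v > 0" using ex_pos_STAB[OF assms] by blast
  have "continuous_on UNIV (\<lambda>u. \<Prod>v\<in>V. pt u v)"
    unfolding pt_def
    by (intro continuous_on_prod continuous_on_sum continuous_on_mult cont continuous_on_const)
  then have "continuous_on K (\<lambda>u. \<Prod>v\<in>V. pt u v)" by (rule continuous_on_subset) simp
  moreover have "K \<noteq> {}" using x0 STAB_K by auto
  ultimately obtain u where u: "u \<in> K" "\<forall>w\<in>K. (\<Prod>v\<in>V. pt w v) \<le> (\<Prod>v\<in>V. pt u v)"
    using continuous_attains_sup[OF \<open>compact K\<close>] by blast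
  define x where "x = pt u"
  have x: "x \<in> STAB V E" using u by (simp add: x_def STAB_K)
  have max: "(\<Prod>v\<in>V. y v) \<le> (\<Prod>v\<in>V. x v)" if "y \<in> STAB V E" for y
    using that u unfolding STAB_K x_def by blast
  have nonneg: "x v \<ge> 0" for v
    using x unfolding STAB_eq[OF fin] by (auto intro!: sum_nonneg)
  have "0 < (\<Prod>v\<in>V. x0 v)" using x0 by (auto intro: prod_pos)
  then have prod_pos: "(\<Prod>v\<in>V. x v) > 0" using max[OF x0(1)] by linarith
  then have pos: "x v > 0" if "v \<in> V" for v
    using nonneg[of v] that fin by (metis less_eq_real_def less_irrefl prod_zero)
  have log_prod_eq: "log 2 (\<Prod>v\<in>V. y v) = (\<Sum>v\<in>V. log 2 (y v))"
    if "\<forall>v\<in>V. y v > 0" for y :: "'a \<Rightarrow> real"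
    using fin that by (subst log_def, subst ln_prod) (auto simp: log_def sum_divide_distrib)
  have "- (1 / real (card V)) * (\<Sum>v\<in>V. log 2 (x v)) \<le> - (1 / real (card V)) * (\<Sum>v\<in>V. log 2 (y v))"
    if y: "y \<in> STAB V E" "\<forall>v\<in>V. y v > 0" for y
  proof -
    have "(\<Prod>v\<in>V. y v) > 0" using y by (auto intro: Groups_Big.linordered_semidom_class.prod_pos)
    then have "log 2 (\<Prod>v\<in>V. y v) \<le> log 2 (\<Prod>v\<in>V. x v)" using max[OF y(1)] by simp
    then show ?thesis
      using pos y(2) log_prod_eq[of x] log_prod_eq[of y]
      by (intro mult_left_mono_neg) auto
  qed
  then show ?thesis using x pos by blast
qed

lemma graph_entropy_attained:
  assumes "finite_simple_graph V E"
  shows "\<exists>x\<in>STAB V E. (\<forall>v\<in>V. x v > 0) \<and>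
    graph_entropy V E = - (1 / real (card V)) * (\<Sum>v\<in>V. log 2 (x v))"
proof -
  obtain x where "x \<in> STAB V E" "\<forall>v\<in>V. x v > 0"
    "\<forall>y\<in>STAB V E. (\<forall>v\<in>V. y v > 0) \<longrightarrow>
      - (1 / real (card V)) * (\<Sum>v\<in>V. log 2 (x v)) \<le> - (1 / real (card V)) * (\<Sum>v\<in>V. log 2 (y v))"
    using graph_entropy_minimizer[OF assms] by blast
  moreover from this have "graph_entropy V E = - (1 / real (card V)) * (\<Sum>v\<in>V. log 2 (x v))"
    unfolding graph_entropy_def by (intro Least_equality) auto
  ultimately show ?thesis by blast
qed

lemma graph_entropy_le:
  assumes "finite_simple_graph V E" "y \<in> STAB V E" "\<forall>v\<in>V. y v > 0"
  shows "graph_entropy V E \<le> - (1 / real (card V)) * (\<Sum>v\<in>V. log 2 (y v))"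
proof -
  obtain x where x: "x \<in> STAB V E" "\<forall>v\<in>V. x v > 0"
    "\<forall>y\<in>STAB V E. (\<forall>v\<in>V. y v > 0) \<longrightarrow>
      - (1 / real (card V)) * (\<Sum>v\<in>V. log 2 (x v)) \<le> - (1 / real (card V)) * (\<Sum>v\<in>V. log 2 (y v))"
    using graph_entropy_minimizer[OF assms(1)] by blast
  from x have "graph_entropy V E = - (1 / real (card V)) * (\<Sum>v\<in>V. log 2 (x v))"
    unfolding graph_entropy_def by (intro Least_equality) auto
  with x assms show ?thesis by auto
qed

end

theory Submission
  imports Defs
begin

text \<open>Let \<open>x\<close> be the optimal point of \<open>STAB\<close> of the incomparability graph, let \<open>n\<close> be the
  number of elements of the poset and \<open>\<gamma> = 2 - \<epsilon>\<close>. Optimality says that every chain has weight at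
  most \<open>n\<close> with respect to the weights \<open>1 / x v\<close>, with equality for the chains occurring in a convex
  representation of \<open>x\<close>. Placing each \<open>v\<close> as an interval \<open>[s v, t v)\<close> of length \<open>1 / x v\<close> on top of
  the heaviest chain below it, the poset is laid out along \<open>[0, n)\<close> such that comparable elements
  are disjoint and every point is covered either by one element with \<open>x = 1\<close> or by two elements
  whose \<open>x\<close>-values add up to \<open>1\<close>.

  The upper bound on the entropy uses not \<open>x\<close> itself but \<open>x\<close> rounded monotonically and
  symmetrically to the values \<open>1 / k\<close> and \<open>1 - 1 / k\<close>, which remains in \<open>STAB\<close> because the graph
  is bipartite. The number of linear extensions is bounded from below along the layout, from right
  to left: if \<open>a\<close> and \<open>b\<close> are active at the same time, there are at least as many extensions as for
  the elements ending after \<open>a\<close> and for those ending after \<open>b\<close> together. With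
  \<open>\<beta> = 2 powr (1 / \<gamma>)\<close>, an element of rounded value \<open>1 / k\<close> with \<open>k \<ge> 3\<close> and the
  \<open>m \<in> {k - 1, k}\<close> elements ending beside it form a star contributing a factor \<open>m + 1\<close>; this is
  tight for \<open>k = 3\<close>, \<open>m = 2\<close> and determines \<open>\<gamma>\<close>. Stretches of rounded value \<open>1 / 2\<close> have
  Fibonacci-like growth, which beats \<open>\<beta>\<close> per element except for a single pair. Such a pair is a
  component of the graph, accounted for by \<open>\<kappa>\<^sub>2\<close>, or it is incomparable to something in a
  neighbouring stretch, and the additional extensions make up for the loss.\<close>

section \<open>Counting linear extensions\<close>

definition minimal_in :: "'a rel \<Rightarrow> 'a set \<Rightarrow> 'a \<Rightarrow> bool" where
  "minimal_in r U u \<longleftrightarrow> u \<in> U \<and> (\<forall>v\<in>U. (v, u) \<in> r \<longrightarrow> v = u)"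

definition up_closed :: "'a set \<Rightarrow> 'a rel \<Rightarrow> 'a set \<Rightarrow> bool" where
  "up_closed A r X \<longleftrightarrow> X \<subseteq> A \<and> (\<forall>u\<in>X. \<forall>v\<in>A. (u, v) \<in> r \<longrightarrow> v \<in> X)"

definition num_linear_extensions :: "'a rel \<Rightarrow> 'a set \<Rightarrow> nat" where
  "num_linear_extensions r U = card (linear_extensions U (Restr r U))"

definition put_first :: "'a \<Rightarrow> 'a set \<Rightarrow> 'a rel \<Rightarrow> 'a rel" where
  "put_first u U s = s \<union> {u} \<times> U"

lemma exists_minimal_in:
  assumes "finite U" "partial_order_on A r" "U \<noteq> {}"
  shows "\<exists>u. minimal_in r U u"
proof -
  have "transp_on U (\<lambda>v u. (v, u) \<in> r \<and> v \<noteq> u)"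
    using partial_order_onD(2,3)[OF assms(2)] by (intro transp_onI) (metis antisymD transD)
  moreover have "asymp_on U (\<lambda>v u. (v, u) \<in> r \<and> v \<noteq> u)"
    using partial_order_onD(3)[OF assms(2)] by (intro asymp_onI) (auto dest: antisymD)
  ultimately show ?thesis
    using Finite_Set.bex_min_element[OF assms(1) _ _ assms(3)] unfolding minimal_in_def by blast
qed

lemma up_closed_remove_minimal:
  "up_closed A r X \<Longrightarrow> minimal_in r X u \<Longrightarrow> up_closed A r (X - {u})"
  unfolding up_closed_def minimal_in_def by blast

lemma num_linear_extensions_empty: "num_linear_extensions r {} = 1"
proof -
  have "linear_extensions {} (Restr r {}) = {{}}"
    by (auto simp: linear_extensions_def order_on_defs
        refl_on_def antisym_def trans_def total_on_def)
  then show ?thesis by (simp add: num_linear_extensions_def)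
qed

lemma put_first_linear_extension:
  assumes "minimal_in r U u" and "s \<in> linear_extensions (U - {u}) (Restr r (U - {u}))"
  shows "put_first u U s \<in> linear_extensions U (Restr r U)"
proof -
  have s: "refl_on (U - {u}) s" "trans s" "antisym s" "total_on (U - {u}) s"
    "s \<subseteq> (U - {u}) \<times> (U - {u})" "Restr r (U - {u}) \<subseteq> s"
    using assms(2) by (auto simp: linear_extensions_def order_on_defs)
  have u: "u \<in> U" "\<And>v. v \<in> U \<Longrightarrow> (v, u) \<in> r \<Longrightarrow> v = u"
    using assms(1) by (auto simp: minimal_in_def)
  have "trans (s \<union> {u} \<times> U)"
    using s(2,5) u(1) unfolding trans_def by blast
  moreover have "antisym (s \<union> {u} \<times> U)"
    using s(3,5) unfolding antisym_def by blast
  moreover have "refl_on U (s \<union> {u} \<times> U)"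
    using s(1) u(1) unfolding refl_on_def by blast
  moreover have "total_on U (s \<union> {u} \<times> U)"
    using s(4) u(1) unfolding total_on_def by blast
  moreover have "s \<union> {u} \<times> U \<subseteq> U \<times> U" using s(5) u(1) by blast
  moreover have "Restr r U \<subseteq> s \<union> {u} \<times> U" using s(6) u by blast
  ultimately show ?thesis
    by (simp add: put_first_def linear_extensions_def order_on_defs)
qed

lemma inj_on_put_first:
  "inj_on (put_first u U) (linear_extensions (U - {u}) (Restr r (U - {u})))"
proof (rule inj_onI)
  fix s s'
  assume "s \<in> linear_extensions (U - {u}) (Restr r (U - {u}))"
    and "s' \<in> linear_extensions (U - {u}) (Restr r (U - {u}))"
    and eq: "put_first u U s = put_first u U s'"
  then have "s \<subseteq> (U - {u}) \<times> (U - {u})" "s' \<subseteq> (U - {u}) \<times> (U - {u})"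
    by (auto simp: linear_extensions_def order_on_defs)
  then show "s = s'" using eq unfolding put_first_def by blast
qed

lemma put_first_image_disjoint:
  assumes "minimal_in r U u" "minimal_in r U v" "u \<noteq> v"
  shows "put_first u U ` linear_extensions (U - {u}) (Restr r (U - {u}))
    \<inter> put_first v U ` linear_extensions (U - {v}) (Restr r (U - {v})) = {}"
proof (rule ccontr)
  assume "\<not> ?thesis"
  then obtain s s' where s: "s \<in> linear_extensions (U - {u}) (Restr r (U - {u}))"
    "put_first u U s = put_first v U s'" by blast
  have "antisym (put_first u U s)"
    using put_first_linear_extension[OF assms(1) s(1)]
    by (auto simp: linear_extensions_def order_on_defs)
  moreover have "(u, v) \<in> put_first u U s" "(v, u) \<in> put_first v U s'"
    using assms(1,2) by (auto simp: put_first_def minimal_in_def)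
  ultimately show False using s(2) assms(3) by (auto dest: antisymD)
qed

lemma num_linear_extensions_remove_minimal:
  assumes "finite U" "minimal_in r U u"
  shows "num_linear_extensions r (U - {u}) \<le> num_linear_extensions r U"
  unfolding num_linear_extensions_def
proof (rule card_inj_on_le[OF inj_on_put_first])
  show "put_first u U ` linear_extensions (U - {u}) (Restr r (U - {u}))
    \<subseteq> linear_extensions U (Restr r U)"
    using put_first_linear_extension[OF assms(2)] by blast
qed (rule finite_linear_extensions[OF assms(1)])

lemma num_linear_extensions_remove_two_minimal:
  assumes "finite U" "minimal_in r U u" "minimal_in r U v" "u \<noteq> v"
  shows "num_linear_extensions r (U - {u}) + num_linear_extensions r (U - {v})
    \<le> num_linear_extensions r U"
proof -
  define \<L> where "\<L> w = linear_extensions (U - {w}) (Restr r (U - {w}))" for w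
  have fin: "finite (\<L> w)" for w
    unfolding \<L>_def using assms(1) by (intro finite_linear_extensions) simp
  have card: "card (put_first w U ` \<L> w) = card (\<L> w)" for w
    unfolding \<L>_def by (rule card_image[OF inj_on_put_first])
  have "card (\<L> u) + card (\<L> v) = card (put_first u U ` \<L> u \<union> put_first v U ` \<L> v)"
    using fin put_first_image_disjoint[OF assms(2-4), folded \<L>_def]
    by (subst card_Un_disjoint) (auto simp: card)
  also have "\<dots> \<le> card (linear_extensions U (Restr r U))"
    using put_first_linear_extension[OF assms(2)] put_first_linear_extension[OF assms(3)] assms(1)
    unfolding \<L>_def by (intro card_mono finite_linear_extensions) auto
  finally show ?thesis by (simp add: num_linear_extensions_def \<L>_def)
qed

lemma num_linear_extensions_mono:
  assumes "finite A" "partial_order_on A r" "up_closed A r X" "X \<subseteq> U" "U \<subseteq> A"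
  shows "num_linear_extensions r X \<le> num_linear_extensions r U"
  using assms(4,5)
proof (induction "card U" arbitrary: U rule: less_induct)
  case less
  have fin: "finite U" using less.prems(2) assms(1) by (rule finite_subset)
  show ?case
  proof (cases "U = X")
    case False
    then have "U - X \<noteq> {}" using less.prems(1) by blast
    then obtain m where m: "minimal_in r (U - X) m"
      using exists_minimal_in[OF _ assms(2)] fin by blast
    then have mU: "m \<in> U" "m \<notin> X" "minimal_in r U m"
      using assms(3) less.prems unfolding minimal_in_def up_closed_def by blast+
    then have "num_linear_extensions r X \<le> num_linear_extensions r (U - {m})"
      using less.prems fin by (intro less.hyps card_Diff1_less) auto
    also have "\<dots> \<le> num_linear_extensions r U"
      by (rule num_linear_extensions_remove_minimal[OF fin mU(3)])
    finally show ?thesis .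
  qed simp
qed

lemma num_linear_extensions_branch:
  assumes "finite A" "partial_order_on A r" "U \<subseteq> A"
    and "minimal_in r U u" "minimal_in r U v" "u \<noteq> v"
    and "up_closed A r X" "X \<subseteq> U - {u}" "up_closed A r Y" "Y \<subseteq> U - {v}"
  shows "num_linear_extensions r X + num_linear_extensions r Y \<le> num_linear_extensions r U"
proof -
  have "num_linear_extensions r X \<le> num_linear_extensions r (U - {u})"
    "num_linear_extensions r Y \<le> num_linear_extensions r (U - {v})"
    using assms by (auto intro!: num_linear_extensions_mono[OF assms(1,2)])
  then show ?thesis
    using num_linear_extensions_remove_two_minimal[OF finite_subset[OF assms(3,1)] assms(4-6)]
    by linarith
qed


section \<open>Dilworth's theorem\<close>

definition chain_colouring :: "'a rel \<Rightarrow> 'a set \<Rightarrow> nat \<Rightarrow> ('a \<Rightarrow> nat) \<Rightarrow> bool" where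
  "chain_colouring r U k f \<longleftrightarrow>
    f ` U \<subseteq> {..<k} \<and> (\<forall>u\<in>U. \<forall>v\<in>U. f u = f v \<longrightarrow> (u, v) \<in> r \<or> (v, u) \<in> r)"

lemma finite_chain_has_maximum:
  assumes "partial_order_on A r" "finite C" "C \<noteq> {}"
    and "\<And>u v. u \<in> C \<Longrightarrow> v \<in> C \<Longrightarrow> (u, v) \<in> r \<or> (v, u) \<in> r"
  obtains m where "m \<in> C" "\<And>u. u \<in> C \<Longrightarrow> (u, m) \<in> r"
proof -
  have "partial_order_on A (r\<inverse>)" using assms(1) by simp
  then obtain m where "minimal_in (r\<inverse>) C m" using exists_minimal_in assms(2,3) by blast
  then show thesis using that assms(4) unfolding minimal_in_def by (metis converse_iff)
qed

lemma antichain_mono: "antichain U r S \<Longrightarrow> U \<subseteq> V \<Longrightarrow> antichain V r S"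
  by (auto simp: antichain_def)

lemma antichain_meets_every_colour:
  assumes "chain_colouring r U k f" "antichain U r S" "card S = k" "i < k"
  obtains v where "v \<in> S" "f v = i"
proof -
  have "inj_on f S"
    using assms(1,2) unfolding chain_colouring_def antichain_def inj_on_def by blast
  then have "card (f ` S) = card {..<k}" using assms(3) by (simp add: card_image)
  moreover have "f ` S \<subseteq> {..<k}"
    using assms(1,2) unfolding chain_colouring_def antichain_def by blast
  ultimately have "f ` S = {..<k}" by (intro card_subset_eq) auto
  then show thesis using that assms(4) by (metis imageE lessThan_iff)
qed

lemma chain_colouring_insert_chain:
  assumes "chain_colouring r (U - K) k f" "\<And>u v. u \<in> K \<Longrightarrow> v \<in> K \<Longrightarrow> (u, v) \<in> r \<or> (v, u) \<in> r"
  shows "chain_colouring r U (Suc k) (\<lambda>v. if v \<in> K then k else f v)"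
  unfolding chain_colouring_def
proof (intro conjI ballI impI)
  have less: "f v < k" if "v \<in> U - K" for v
    using assms(1) that unfolding chain_colouring_def by blast
  show "(\<lambda>v. if v \<in> K then k else f v) ` U \<subseteq> {..<Suc k}"
    using less by (auto simp: less_Suc_eq)
  fix u v
  assume "u \<in> U" "v \<in> U" "(if u \<in> K then k else f u) = (if v \<in> K then k else f v)"
  then consider "u \<in> K" "v \<in> K" | "u \<in> U - K" "v \<in> U - K" "f u = f v"
    using less[of u] less[of v] by (auto split: if_splits)
  then show "(u, v) \<in> r \<or> (v, u) \<in> r"
    using assms unfolding chain_colouring_def by cases blast+
qed

text \<open>The witness \<open>m i\<close> is the largest element of colour \<open>i\<close> that lies on an antichain of size \<open>k\<close>.\<close>

lemma antichain_of_colour_maxima: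
  assumes po: "partial_order_on A r" and fin: "finite U" and col: "chain_colouring r U k f"
    and S\<^sub>0: "antichain U r S\<^sub>0" "card S\<^sub>0 = k"
  obtains m where "antichain U r (m ` {..<k})" "\<And>i. i < k \<Longrightarrow> f (m i) = i"
    "\<And>S v. antichain U r S \<Longrightarrow> card S = k \<Longrightarrow> v \<in> S \<Longrightarrow> (v, m (f v)) \<in> r"
proof -
  define C where "C i = {v. f v = i \<and> (\<exists>S. antichain U r S \<and> card S = k \<and> v \<in> S)}" for i
  have CU: "C i \<subseteq> U" for i unfolding C_def antichain_def by blast
  have "\<exists>m. m \<in> C i \<and> (\<forall>u\<in>C i. (u, m) \<in> r)" if i: "i < k" for i
  proof -
    obtain v where "v \<in> S\<^sub>0" "f v = i" using antichain_meets_every_colour[OF col S\<^sub>0 i] .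
    then have "C i \<noteq> {}" using S\<^sub>0 unfolding C_def by blast
    moreover have "(u, v) \<in> r \<or> (v, u) \<in> r" if "u \<in> C i" "v \<in> C i" for u v
      using col CU that unfolding chain_colouring_def C_def by blast
    ultimately show ?thesis using finite_chain_has_maximum[OF po finite_subset[OF CU fin]] by metis
  qed
  then obtain m where m: "\<And>i. i < k \<Longrightarrow> m i \<in> C i" "\<And>i u. i < k \<Longrightarrow> u \<in> C i \<Longrightarrow> (u, m i) \<in> r"
    by metis
  have f_m: "f (m i) = i" if "i < k" for i using m(1)[OF that] unfolding C_def by blast
  have "(m i, m j) \<notin> r" if ij: "i < k" "j < k" "i \<noteq> j" for i j
  proof
    assume le: "(m i, m j) \<in> r"
    obtain S where S: "antichain U r S" "card S = k" "m j \<in> S"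
      using m(1)[OF ij(2)] unfolding C_def by blast
    obtain v where v: "v \<in> S" "f v = i"
      using antichain_meets_every_colour[OF col S(1,2) ij(1)] .
    then have "(v, m i) \<in> r" using m(2)[OF ij(1)] S unfolding C_def by blast
    then have "(v, m j) \<in> r" using le partial_order_onD(2)[OF po] by (meson transD)
    moreover have "v \<noteq> m j" using v(2) f_m ij by blast
    ultimately show False using S v(1) unfolding antichain_def by blast
  qed
  then have "antichain U r (m ` {..<k})"
    using m(1) CU unfolding antichain_def by blast
  moreover have "(v, m (f v)) \<in> r" if "antichain U r S" "card S = k" "v \<in> S" for S v
  proof (rule m(2))
    show "f v < k" using col that unfolding chain_colouring_def antichain_def by blast
  qed (use that in \<open>auto simp: C_def\<close>)
  ultimately show thesis using that f_m by blast
qed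

lemma exists_colour_maximum_below:
  assumes a: "minimal_in (r\<inverse>) U a"
    and le_k: "\<And>S. antichain U r S \<Longrightarrow> card S \<le> k"
    and m: "antichain (U - {a}) r (m ` {..<k})" "\<And>i. i < k \<Longrightarrow> f (m i) = i"
  shows "\<exists>i<k. (m i, a) \<in> r"
proof (rule ccontr)
  assume "\<not> ?thesis"
  then have "antichain U r (insert a (m ` {..<k}))"
    using m(1) a unfolding antichain_def minimal_in_def by blast
  moreover have "inj_on m {..<k}" using m(2) by (intro inj_on_inverseI[of _ f]) auto
  then have "card (m ` {..<k}) = k" by (simp add: card_image)
  moreover have "a \<notin> m ` {..<k}" using m(1) unfolding antichain_def by blast
  ultimately show False using le_k by fastforce
qed

lemma exists_chain_meeting_large_antichains:
  assumes po: "partial_order_on A r" and fin: "finite U" and "U \<subseteq> A" and a: "minimal_in (r\<inverse>) U a"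
    and le_k: "\<And>S. antichain U r S \<Longrightarrow> card S \<le> k"
    and col: "chain_colouring r (U - {a}) k f"
  obtains K where "a \<in> K" "K \<subseteq> U" "\<And>u v. u \<in> K \<Longrightarrow> v \<in> K \<Longrightarrow> (u, v) \<in> r \<or> (v, u) \<in> r"
    "\<And>S. antichain (U - K) r S \<Longrightarrow> card S \<noteq> k"
proof (cases "\<exists>S. antichain (U - {a}) r S \<and> card S = k")
  case False
  have "a \<in> U" using a by (simp add: minimal_in_def)
  moreover from this have "(a, a) \<in> r"
    using partial_order_onD(1)[OF po] assms(3) by (auto simp: refl_on_def)
  ultimately show thesis using that[of "{a}"] False by blast
next
  case True
  then obtain m where m: "antichain (U - {a}) r (m ` {..<k})" "\<And>i. i < k \<Longrightarrow> f (m i) = i"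
    "\<And>S v. antichain (U - {a}) r S \<Longrightarrow> card S = k \<Longrightarrow> v \<in> S \<Longrightarrow> (v, m (f v)) \<in> r"
    using antichain_of_colour_maxima[OF po _ col] fin by (metis finite_Diff)
  obtain i where i: "i < k" "(m i, a) \<in> r"
    using exists_colour_maximum_below[OF a le_k m(1,2)] by blast
  define K where "K = insert a {v \<in> U - {a}. f v = i \<and> (v, m i) \<in> r}"
  have K: "a \<in> K" "K \<subseteq> U" using a unfolding K_def minimal_in_def by auto
  have below_a: "(v, a) \<in> r" if "v \<in> K" for v
    using that i(2) K assms(3) partial_order_onD(1,2)[OF po]
    unfolding K_def by (auto dest: transD simp: refl_on_def)
  have "(u, v) \<in> r \<or> (v, u) \<in> r" if "u \<in> K" "v \<in> K" for u v
  proof (cases "u = a \<or> v = a")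
    case False
    then show ?thesis using that col unfolding K_def chain_colouring_def by blast
  qed (use that below_a in blast)
  moreover have "card S \<noteq> k" if S: "antichain (U - K) r S" for S
  proof
    assume "card S = k"
    moreover have S': "antichain (U - {a}) r S"
      using S by (rule antichain_mono) (auto simp: K_def)
    ultimately obtain v where "v \<in> S" "f v = i" "(v, m i) \<in> r"
      using antichain_meets_every_colour[OF col] i(1) m(3) by metis
    then show False using S S' unfolding K_def antichain_def by blast
  qed
  ultimately show thesis using that K by blast
qed

text \<open>Galvin's proof: for a maximal element \<open>a\<close>, there is a chain through \<open>a\<close> that meets every
  antichain of size \<open>k\<close>.\<close>

theorem dilworth:
  assumes "partial_order_on A r" "finite U" "U \<subseteq> A" "\<And>S. antichain U r S \<Longrightarrow> card S \<le> k"
  shows "\<exists>f. chain_colouring r U k f"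
  using assms(2-4)
proof (induction "card U" arbitrary: U k rule: less_induct)
  case less
  show ?case
  proof (cases "U = {}")
    case False
    have "partial_order_on A (r\<inverse>)" using assms(1) by simp
    then obtain a where a: "minimal_in (r\<inverse>) U a"
      using exists_minimal_in less.prems(1) False by blast
    then have "a \<in> U" by (simp add: minimal_in_def)
    then have "\<exists>f. chain_colouring r (U - {a}) k f"
      using less.prems antichain_mono[of "U - {a}" r _ U] by (intro less.hyps card_Diff1_less) auto
    then obtain K where K: "a \<in> K" "K \<subseteq> U"
      "\<And>u v. u \<in> K \<Longrightarrow> v \<in> K \<Longrightarrow> (u, v) \<in> r \<or> (v, u) \<in> r"
      "\<And>S. antichain (U - K) r S \<Longrightarrow> card S \<noteq> k"
      using exists_chain_meeting_large_antichains[OF assms(1) less.prems(1,2) a less.prems(3)]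
      by metis
    have "card (U - K) < card U"
      using K(1,2) less.prems(1) by (intro psubset_card_mono) auto
    moreover have "card S \<le> k - 1" if "antichain (U - K) r S" for S
      using K(4)[OF that] less.prems(3)[OF antichain_mono[OF that Diff_subset]] by simp
    ultimately obtain f where "chain_colouring r (U - K) (k - 1) f"
      using less.hyps[of "U - K"] less.prems(1,2) by blast
    then have "chain_colouring r U (Suc (k - 1)) (\<lambda>v. if v \<in> K then k - 1 else f v)"
      using K(3) by (rule chain_colouring_insert_chain)
    moreover have "k \<noteq> 0" using K(4)[of "{}"] by (auto simp: antichain_def)
    ultimately show ?thesis by auto
  qed (auto intro: exI[of _ "\<lambda>_. 0"] simp: chain_colouring_def)
qed


section \<open>Points of the stable set polytope\<close>

lemma convex_STAB: "convex (STAB V E)"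
  unfolding STAB_def by (rule convex_convex_hull)

lemma indicator_in_STAB: "stable_set V E S \<Longrightarrow> indicator S \<in> STAB V E"
  unfolding STAB_def by (intro hull_inc) auto

lemma STAB_edge_le_1:
  assumes "x \<in> STAB V E" "(u, v) \<in> E"
  shows "x u + x v \<le> 1"
proof -
  have "STAB V E \<subseteq> {x. x u + x v \<le> 1}"
    unfolding STAB_def
  proof (rule hull_minimal)
    show "indicator ` {S. stable_set V E S} \<subseteq> {x :: 'a \<Rightarrow> real. x u + x v \<le> 1}"
      using assms(2) by (auto simp: stable_set_def indicator_def)
    show "convex {x :: 'a \<Rightarrow> real. x u + x v \<le> 1}"
    proof (rule convexI)
      fix y z :: "'a \<Rightarrow> real" and a b :: real
      assume "y \<in> {x. x u + x v \<le> 1}" "z \<in> {x. x u + x v \<le> 1}" "0 \<le> a" "0 \<le> b" "a + b = 1"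
      then have "a * (y u + y v) + b * (z u + z v) \<le> 1" by (intro convex_bound_le) auto
      then show "a *\<^sub>R y + b *\<^sub>R z \<in> {x. x u + x v \<le> 1}" by (simp add: algebra_simps)
    qed
  qed
  then show ?thesis using assms(1) by blast
qed

definition gap :: "'b :: linordered_ab_group_add set \<Rightarrow> 'b \<Rightarrow> 'b" where
  "gap Q q = Min {p \<in> Q. q < p} - q"

lemma gap_nonneg:
  assumes "finite Q" "d \<in> Q" "q < d"
  shows "0 \<le> gap Q q"
proof -
  have "Min {p \<in> Q. q < p} \<in> {p \<in> Q. q < p}" using assms by (intro Min_in) auto
  then show ?thesis unfolding gap_def by (simp add: less_imp_le)
qed

lemma sum_gap:
  assumes "finite Q" "c \<in> Q" "d \<in> Q" "c \<le> d"
  shows "sum (gap Q) {q \<in> Q. c \<le> q \<and> q < d} = d - c"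
  using assms(2,4)
proof (induction "card {q \<in> Q. c \<le> q \<and> q < d}" arbitrary: c rule: less_induct)
  case less
  show ?case
  proof (cases "c = d")
    case True
    then have empty: "{q \<in> Q. c \<le> q \<and> q < d} = {}" by auto
    show ?thesis unfolding empty using True by simp
  next
    case False
    define e where "e = Min {p \<in> Q. c < p}"
    have fin: "finite {p \<in> Q. c < p}" using assms(1) by simp
    have d: "d \<in> {p \<in> Q. c < p}" using assms(3) less.prems False by simp
    then have "e \<in> {p \<in> Q. c < p}" unfolding e_def using fin by (intro Min_in) auto
    then have e: "e \<in> Q" "c < e" by auto
    have e_le: "e \<le> q" if "q \<in> Q" "c < q" for q
      unfolding e_def using fin that by (intro Min_le) auto
    have split: "{q \<in> Q. c \<le> q \<and> q < d} = insert c {q \<in> Q. e \<le> q \<and> q < d}"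
      using e e_le d less.prems(1) by force
    have new: "c \<notin> {q \<in> Q. e \<le> q \<and> q < d}" "finite {q \<in> Q. e \<le> q \<and> q < d}"
      using e assms(1) by auto
    have "sum (gap Q) {q \<in> Q. e \<le> q \<and> q < d} = d - e"
    proof (rule less.hyps)
      show "card {q \<in> Q. e \<le> q \<and> q < d} < card {q \<in> Q. c \<le> q \<and> q < d}"
        unfolding split using new by simp
      show "e \<le> d" using e_le d by simp
    qed (rule e(1))
    then show ?thesis unfolding split using new by (simp add: gap_def flip: e_def)
  qed
qed

definition threshold_set :: "'a set \<Rightarrow> 'a set \<Rightarrow> ('a \<Rightarrow> real) \<Rightarrow> real \<Rightarrow> 'a set" where
  "threshold_set C D y q = {u \<in> C. q < y u} \<union> {v \<in> D. 1 - y v \<le> q}"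

lemma threshold_set_stable:
  assumes "stable_set V E C" "stable_set V E D" "\<And>u v. (u, v) \<in> E \<Longrightarrow> y u + y v \<le> 1"
  shows "stable_set V E (threshold_set C D y q)"
proof -
  have "(u, v) \<notin> E" if uv: "u \<in> threshold_set C D y q" "v \<in> threshold_set C D y q" for u v
  proof
    assume E: "(u, v) \<in> E"
    consider "u \<in> C" "v \<in> C" | "u \<in> D" "v \<in> D"
      | "q < y u" "1 - y v \<le> q" | "1 - y u \<le> q" "q < y v"
      using uv unfolding threshold_set_def by blast
    then show False using assms(1,2) assms(3)[OF E] E unfolding stable_set_def by cases auto
  qed
  then show ?thesis using assms(1,2) unfolding threshold_set_def stable_set_def by blast
qed

lemma sum_gap_threshold_set:
  assumes "finite Q" "{0, 1} \<subseteq> Q" "y ` C \<subseteq> Q" "(\<lambda>v. 1 - y v) ` D \<subseteq> Q" "C \<inter> D = {}"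
    and y: "\<And>v. v \<in> C \<union> D \<Longrightarrow> 0 \<le> y v \<and> y v \<le> 1" "\<And>v. v \<notin> C \<union> D \<Longrightarrow> y v = 0"
  shows "sum (gap Q) {q \<in> {q \<in> Q. 0 \<le> q \<and> q < 1}. v \<in> threshold_set C D y q} = y v"
    (is "sum _ ?I = _")
proof -
  consider "v \<in> C" "v \<notin> D" | "v \<in> D" "v \<notin> C" | "v \<notin> C \<union> D" using assms(5) by blast
  then show ?thesis
  proof cases
    case 1
    then have "?I = {q \<in> Q. 0 \<le> q \<and> q < y v}"
      using y(1)[of v] unfolding threshold_set_def by auto
    then show ?thesis using sum_gap[OF assms(1), of 0 "y v"] y(1)[of v] 1 assms(2,3) by auto
  next
    case 2
    then have "?I = {q \<in> Q. 1 - y v \<le> q \<and> q < 1}"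
      using y(1)[of v] unfolding threshold_set_def by auto
    then show ?thesis using sum_gap[OF assms(1), of "1 - y v" 1] y(1)[of v] 2 assms(2,4) by auto
  next
    case 3
    then have empty: "?I = {}" unfolding threshold_set_def by blast
    show ?thesis unfolding empty using y(2)[OF 3] by simp
  qed
qed

text \<open>For \<open>q\<close> uniformly distributed on \<open>[0, 1]\<close>, the threshold set contains \<open>v\<close> with probability
  \<open>y v\<close>; it only changes at the finitely many points of \<open>Q\<close>.\<close>

lemma bipartite_fractional_in_STAB:
  assumes "finite V" "stable_set V E C" "stable_set V E D" and V: "V = C \<union> D" "C \<inter> D = {}"
    and y: "\<And>v. v \<in> V \<Longrightarrow> 0 \<le> y v \<and> y v \<le> 1" "\<And>v. v \<notin> V \<Longrightarrow> y v = 0"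
    and edge: "\<And>u v. (u, v) \<in> E \<Longrightarrow> y u + y v \<le> 1"
  shows "y \<in> STAB V E"
proof -
  define Q where "Q = {0, 1} \<union> y ` C \<union> (\<lambda>v. 1 - y v) ` D"
  define I where "I = {q \<in> Q. 0 \<le> q \<and> q < 1}"
  define T where "T = threshold_set C D y"
  have finQ: "finite Q" unfolding Q_def using assms(1) V(1) by simp
  then have finI: "finite I" unfolding I_def by simp
  have "sum (gap Q) I = 1" unfolding I_def using sum_gap[OF finQ, of 0 1] by (simp add: Q_def)
  moreover have "0 \<le> gap Q q" if "q \<in> I" for q
    using that by (intro gap_nonneg[OF finQ, of 1]) (auto simp: I_def Q_def)
  ultimately have "(\<Sum>q\<in>I. gap Q q *\<^sub>R indicator (T q)) \<in> STAB V E"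
    using finI threshold_set_stable[OF assms(2,3) edge] unfolding T_def
    by (intro convex_sum[OF _ convex_STAB] indicator_in_STAB)
  moreover have "(\<Sum>q\<in>I. gap Q q *\<^sub>R indicator (T q)) v = y v" for v
  proof -
    have "(\<Sum>q\<in>I. gap Q q *\<^sub>R indicator (T q)) v = sum (gap Q) {q \<in> I. v \<in> T q}"
      using finI by (simp add: sum_fun_apply indicator_def sum.If_cases Int_def)
    also have "\<dots> = y v"
      unfolding I_def T_def using y V
      by (intro sum_gap_threshold_set[OF finQ]) (auto simp: Q_def)
    finally show ?thesis .
  qed
  ultimately show ?thesis by (metis ext)
qed

lemma card_mult_graph_entropy_le:
  assumes "finite_simple_graph V E" "y \<in> STAB V E" "\<And>v. v \<in> V \<Longrightarrow> 0 < y v"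
  shows "real (card V) * graph_entropy V E \<le> (\<Sum>v\<in>V. - log 2 (y v))"
proof (cases "V = {}")
  case False
  then have "0 < real (card V)"
    using assms(1) by (simp add: finite_simple_graph_def card_gt_0_iff)
  then show ?thesis
    using graph_entropy_le[OF assms(1,2)] assms(3) by (simp add: field_simps sum_negf)
qed simp


section \<open>Optimal points\<close>

text \<open>First-order optimality in the direction of \<open>y\<close>.\<close>

lemma sum_ln_maximizer_gradient:
  fixes x y :: "'a \<Rightarrow> real"
  assumes "convex K" "x \<in> K" "y \<in> K"
    and x: "\<And>v. v \<in> V \<Longrightarrow> 0 < x v" and y: "\<And>v. v \<in> V \<Longrightarrow> 0 \<le> y v"
    and maximal: "\<And>z. z \<in> K \<Longrightarrow> (\<forall>v\<in>V. 0 < z v) \<Longrightarrow> (\<Sum>v\<in>V. ln (z v)) \<le> (\<Sum>v\<in>V. ln (x v))"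
  shows "(\<Sum>v\<in>V. y v / x v) \<le> real (card V)"
proof (rule ccontr)
  assume neg: "\<not> ?thesis"
  define f where "f h = (\<Sum>v\<in>V. ln (x v + h * (y v - x v)))" for h
  have "((\<lambda>h. ln (x v + h * (y v - x v))) has_real_derivative (y v - x v) / x v) (at 0)"
    if "v \<in> V" for v
    using x[OF that] by (auto intro!: derivative_eq_intros)
  then have "(f has_real_derivative (\<Sum>v\<in>V. (y v - x v) / x v)) (at 0)"
    unfolding f_def by (intro DERIV_sum)
  moreover have "(\<Sum>v\<in>V. (y v - x v) / x v) = (\<Sum>v\<in>V. y v / x v - 1)"
    using less_imp_neq[OF x] by (intro sum.cong refl) (fastforce simp: diff_divide_distrib)
  then have "0 < (\<Sum>v\<in>V. (y v - x v) / x v)" using neg by (simp add: sum_subtractf)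
  ultimately obtain \<delta> where \<delta>: "0 < \<delta>" "\<And>h. 0 < h \<Longrightarrow> h < \<delta> \<Longrightarrow> f 0 < f (0 + h)"
    using DERIV_pos_inc_right by blast
  define h where "h = min (\<delta> / 2) (1 / 2)"
  have h: "0 < h" "h < \<delta>" "h < 1" unfolding h_def using \<delta>(1) by auto
  define z where "z = (1 - h) *\<^sub>R x + h *\<^sub>R y"
  have z: "z v = x v + h * (y v - x v)" for v unfolding z_def by (simp add: algebra_simps)
  have "0 < z v" if "v \<in> V" for v
    unfolding z_def using x[OF that] y[OF that] h by (simp add: add_pos_nonneg)
  moreover have "z \<in> K" unfolding z_def using assms(1-3) h by (intro convexD) auto
  ultimately have "f h \<le> f 0" using maximal[of z] unfolding f_def by (simp add: z)
  then show False using \<delta>(2)[OF h(1,2)] by simp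
qed

lemma sum_stable_set_eq:
  fixes f :: "'a \<Rightarrow> real"
  assumes "finite V" "stable_set V E S"
  shows "sum f S = (\<Sum>v\<in>V. indicator S v * f v)"
  using assms by (intro sum.mono_neutral_cong_left) (auto simp: stable_set_def indicator_def)

lemma sum_stable_set_weights:
  fixes x :: "'a \<Rightarrow> real" and u :: "'a set \<Rightarrow> real"
  assumes "finite V" "\<And>v. x v = (\<Sum>S | stable_set V E S. u S * indicator S v)"
  shows "(\<Sum>S | stable_set V E S. u S * sum f S) = (\<Sum>v\<in>V. x v * f v)"
proof -
  let ?T = "{S. stable_set V E S}"
  have "u S * sum f S = (\<Sum>v\<in>V. u S * indicator S v * f v)" if "S \<in> ?T" for S
  proof -
    have "sum f S = (\<Sum>v\<in>V. indicator S v * f v)"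
      using that by (intro sum_stable_set_eq[OF assms(1)]) simp
    then show ?thesis by (simp only: mult.assoc sum_distrib_left)
  qed
  then have "(\<Sum>S\<in>?T. u S * sum f S) = (\<Sum>S\<in>?T. \<Sum>v\<in>V. u S * indicator S v * f v)"
    by (intro sum.cong refl)
  also have "\<dots> = (\<Sum>v\<in>V. \<Sum>S\<in>?T. u S * indicator S v * f v)" by (rule sum.swap)
  also have "\<dots> = (\<Sum>v\<in>V. x v * f v)" by (simp add: assms(2) flip: sum_distrib_right)
  finally show ?thesis .
qed

lemma ln_optimal_STAB_point:
  assumes "finite_simple_graph V E"
  obtains x where "x \<in> STAB V E" "\<And>v. v \<in> V \<Longrightarrow> 0 < x v"
    "\<And>y. y \<in> STAB V E \<Longrightarrow> (\<forall>v\<in>V. 0 < y v) \<Longrightarrow> (\<Sum>v\<in>V. ln (y v)) \<le> (\<Sum>v\<in>V. ln (x v))"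
proof -
  obtain x where x: "x \<in> STAB V E" "\<forall>v\<in>V. 0 < x v"
    "\<And>y. y \<in> STAB V E \<Longrightarrow> \<forall>v\<in>V. 0 < y v \<Longrightarrow>
      - (1 / real (card V)) * (\<Sum>v\<in>V. log 2 (x v)) \<le> - (1 / real (card V)) * (\<Sum>v\<in>V. log 2 (y v))"
    using graph_entropy_minimizer[OF assms] by blast
  have "(\<Sum>v\<in>V. ln (y v)) \<le> (\<Sum>v\<in>V. ln (x v))" if "y \<in> STAB V E" "\<forall>v\<in>V. 0 < y v" for y
  proof (cases "V = {}")
    case False
    then have "0 < real (card V)"
      using assms by (simp add: finite_simple_graph_def card_gt_0_iff)
    then have "(\<Sum>v\<in>V. log 2 (y v)) \<le> (\<Sum>v\<in>V. log 2 (x v))"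
      using x(3)[OF that] by (simp add: divide_le_cancel)
    then show ?thesis by (simp add: log_def divide_le_cancel flip: sum_divide_distrib)
  qed simp
  then show thesis using that x(1,2) by blast
qed

lemma optimal_STAB_decomposition:
  fixes V :: "'a set"
  assumes "finite_simple_graph V E"
  obtains x :: "'a \<Rightarrow> real" and u :: "'a set \<Rightarrow> real" where "x \<in> STAB V E" "\<And>v. v \<in> V \<Longrightarrow> 0 < x v"
    "\<And>v. x v = (\<Sum>S | stable_set V E S. u S * indicator S v)" "sum u {S. stable_set V E S} = 1"
    "\<And>S. stable_set V E S \<Longrightarrow> (\<Sum>v\<in>S. 1 / x v) \<le> real (card V)"
    "\<And>S. stable_set V E S \<Longrightarrow> u S \<noteq> 0 \<Longrightarrow> (\<Sum>v\<in>S. 1 / x v) = real (card V)"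
proof -
  let ?T = "{S. stable_set V E S}"
  have fin: "finite V" using assms by (simp add: finite_simple_graph_def)
  obtain x where x: "x \<in> STAB V E" "\<And>v. v \<in> V \<Longrightarrow> 0 < x v"
    "\<And>y. y \<in> STAB V E \<Longrightarrow> (\<forall>v\<in>V. 0 < y v) \<Longrightarrow> (\<Sum>v\<in>V. ln (y v)) \<le> (\<Sum>v\<in>V. ln (x v))"
    using ln_optimal_STAB_point[OF assms] by blast
  obtain u where u: "\<forall>S\<in>?T. 0 \<le> u S" "sum u ?T = 1" "x = (\<lambda>v. \<Sum>S\<in>?T. u S * indicator S v)"
    using x(1) unfolding STAB_eq[OF fin] by blast
  have le: "(\<Sum>v\<in>S. 1 / x v) \<le> real (card V)" if S: "stable_set V E S" for S
  proof -
    have "(\<Sum>v\<in>S. 1 / x v) = (\<Sum>v\<in>V. indicator S v * (1 / x v))"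
      by (rule sum_stable_set_eq[OF fin S])
    also have "\<dots> = (\<Sum>v\<in>V. indicator S v / x v)" by (simp only: times_divide_eq_right mult_1_right)
    also have "\<dots> \<le> real (card V)"
      using x indicator_in_STAB[OF S] by (intro sum_ln_maximizer_gradient[OF convex_STAB x(1)]) auto
    finally show ?thesis .
  qed
  have "(\<Sum>S\<in>?T. u S * (\<Sum>v\<in>S. 1 / x v)) = (\<Sum>v\<in>V. x v * (1 / x v))"
    using u(3) by (intro sum_stable_set_weights[OF fin]) auto
  also have "\<dots> = (\<Sum>v\<in>V. 1)" using x(2) by (intro sum.cong) force+
  finally have "(\<Sum>S\<in>?T. u S * (real (card V) - (\<Sum>v\<in>S. 1 / x v))) = 0"
    using u(2) by (simp add: right_diff_distrib sum_subtractf flip: sum_distrib_right)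
  then have "\<forall>S\<in>?T. u S * (real (card V) - (\<Sum>v\<in>S. 1 / x v)) = 0"
    by (subst (asm) sum_nonneg_eq_0_iff) (use finite_stable_sets[OF fin] u(1) le in auto)
  then have "(\<Sum>v\<in>S. 1 / x v) = real (card V)" if "stable_set V E S" "u S \<noteq> 0" for S
    using that by auto
  then show thesis using that[of x u] x(1,2) u(2,3) le by simp
qed


section \<open>Heaviest chains\<close>

locale finite_poset =
  fixes A :: "'a set" and r :: "'a rel"
  assumes finite_A: "finite A"
    and partial_order: "partial_order_on A r"
begin

abbreviation incomparable :: "'a \<Rightarrow> 'a \<Rightarrow> bool" (infix "\<parallel>" 50) where
  "u \<parallel> v \<equiv> (u, v) \<in> incomparability A r"

abbreviation chain :: "'a set \<Rightarrow> bool" where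
  "chain S \<equiv> stable_set A (incomparability A r) S"

lemma le_refl: "v \<in> A \<Longrightarrow> (v, v) \<in> r"
  using partial_order_onD(1)[OF partial_order] by (auto simp: refl_on_def)

lemma le_trans: "(u, v) \<in> r \<Longrightarrow> (v, w) \<in> r \<Longrightarrow> (u, w) \<in> r"
  using partial_order_onD(2)[OF partial_order] by (rule transD)

lemma le_antisym: "(u, v) \<in> r \<Longrightarrow> (v, u) \<in> r \<Longrightarrow> u = v"
  using partial_order_onD(3)[OF partial_order] by (rule antisymD)

lemma le_mem: "(u, v) \<in> r \<Longrightarrow> u \<in> A \<and> v \<in> A"
  using partial_order_onD(4)[OF partial_order] by blast

lemma incomparable_sym: "u \<parallel> v \<Longrightarrow> v \<parallel> u"
  by (auto simp: incomparability_def)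

lemma incomparable_mem: "u \<parallel> v \<Longrightarrow> u \<in> A \<and> v \<in> A \<and> u \<noteq> v"
  by (auto simp: incomparability_def)

lemma incomparable_not_le: "u \<parallel> v \<Longrightarrow> (u, v) \<notin> r \<and> (v, u) \<notin> r"
  by (auto simp: incomparability_def)

lemma chain_iff: "chain S \<longleftrightarrow> S \<subseteq> A \<and> (\<forall>u\<in>S. \<forall>v\<in>S. (u, v) \<in> r \<or> (v, u) \<in> r)"
  unfolding stable_set_def incomparability_def using le_refl by blast

lemma chain_total: "chain S \<Longrightarrow> u \<in> S \<Longrightarrow> v \<in> S \<Longrightarrow> (u, v) \<in> r \<or> (v, u) \<in> r"
  by (simp add: chain_iff)

lemma finite_chain: "chain S \<Longrightarrow> finite S"
  using finite_A finite_subset unfolding stable_set_def by blast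

end

locale weighted_chains = finite_poset +
  fixes len :: "'a \<Rightarrow> real" and L :: real
  assumes chain_len_le: "stable_set A (incomparability A r) S \<Longrightarrow> sum len S \<le> L"
begin

definition chains_below :: "'a \<Rightarrow> 'a set set" where
  "chains_below v = {S. chain S \<and> (\<forall>u\<in>S. (u, v) \<in> r \<and> u \<noteq> v)}"

definition start :: "'a \<Rightarrow> real" where
  "start v = Max (sum len ` chains_below v)"

lemma finite_chains_below: "finite (chains_below v)"
  unfolding chains_below_def using finite_stable_sets[OF finite_A] by simp

lemma start_ge: "S \<in> chains_below v \<Longrightarrow> sum len S \<le> start v"
  unfolding start_def using finite_chains_below by (intro Max_ge) auto

lemma start_nonneg: "0 \<le> start v"
  using start_ge[of "{}" v] by (simp add: chains_below_def chain_iff)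

lemma start_attained:
  obtains S where "S \<in> chains_below v" "start v = sum len S"
proof -
  have "{} \<in> chains_below v" by (simp add: chains_below_def chain_iff)
  then have "start v \<in> sum len ` chains_below v"
    unfolding start_def using finite_chains_below by (intro Max_in) auto
  then show thesis using that by blast
qed

lemma sum_len_insert_below:
  assumes "S \<in> chains_below v"
  shows "sum len (insert v S) = sum len S + len v"
proof -
  have "finite S" "v \<notin> S" using assms finite_chain unfolding chains_below_def by blast+
  then show ?thesis by simp
qed

lemma insert_chain_below:
  assumes "S \<in> chains_below u" "(u, v) \<in> r" "u \<noteq> v"
  shows "insert u S \<in> chains_below v"
  using assms le_mem[OF assms(2)] le_refl le_trans le_antisym
  unfolding chains_below_def chain_iff by blast

lemma end_le_start:
  assumes "(u, v) \<in> r" "u \<noteq> v"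
  shows "start u + len u \<le> start v"
proof -
  obtain S where S: "S \<in> chains_below u" "start u = sum len S" by (rule start_attained)
  then show ?thesis
    using start_ge[OF insert_chain_below[OF S(1) assms]] sum_len_insert_below[OF S(1)] by simp
qed

lemma end_le_L:
  assumes "v \<in> A"
  shows "start v + len v \<le> L"
proof -
  obtain S where S: "S \<in> chains_below v" "start v = sum len S" by (rule start_attained)
  have "chain (insert v S)" using S(1) assms le_refl unfolding chains_below_def chain_iff by blast
  then show ?thesis using chain_len_le[of "insert v S"] sum_len_insert_below[OF S(1)] S(2) by simp
qed

lemma replace_chain_below:
  assumes "chain S" "S' \<in> chains_below v"
  shows "chain (S' \<union> {u \<in> S. (v, u) \<in> r})"
  unfolding chain_iff
proof (intro conjI ballI)
  have S': "(p, v) \<in> r" if "p \<in> S'" for p using assms(2) that unfolding chains_below_def by blast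
  show "S' \<union> {u \<in> S. (v, u) \<in> r} \<subseteq> A"
    using assms(1,2) unfolding chains_below_def chain_iff by blast
  fix a b assume "a \<in> S' \<union> {u \<in> S. (v, u) \<in> r}" "b \<in> S' \<union> {u \<in> S. (v, u) \<in> r}"
  then consider "a \<in> S'" "b \<in> S'" | "(a, v) \<in> r" "(v, b) \<in> r" | "(v, a) \<in> r" "(b, v) \<in> r"
    | "a \<in> S" "b \<in> S"
    using S' by blast
  then show "(a, b) \<in> r \<or> (b, a) \<in> r"
  proof cases
    case 1
    then show ?thesis using assms(2) chain_total unfolding chains_below_def by blast
  next
    case 4
    then show ?thesis using chain_total[OF assms(1)] by blast
  qed (use le_trans in blast)+
qed

text \<open>Replacing the part of \<open>S\<close> below \<open>v\<close> by a heaviest chain below \<open>v\<close> does not increase its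
  length.\<close>

lemma tight_chain_end:
  assumes S: "chain S" "sum len S = L" and v: "v \<in> S"
  shows "start v + len v = sum len {u \<in> S. (u, v) \<in> r}"
proof -
  define B where "B = {u \<in> S. (u, v) \<in> r \<and> u \<noteq> v}"
  define C where "C = {u \<in> S. (v, u) \<in> r}"
  obtain S' where S': "S' \<in> chains_below v" "start v = sum len S'" by (rule start_attained)
  have vA: "v \<in> A" using S(1) v unfolding chain_iff by blast
  have "finite C" using finite_chain[OF S(1)] unfolding C_def by simp
  have B: "B \<in> chains_below v" using S(1) unfolding B_def chains_below_def chain_iff by blast
  have disjoint: "X \<inter> C = {}" if "X \<in> chains_below v" for X
    using that le_antisym unfolding chains_below_def C_def by blast
  have sum_Un: "sum len (X \<union> C) = sum len X + sum len C" if "X \<in> chains_below v" for X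
    using that disjoint[OF that] \<open>finite C\<close> finite_chain unfolding chains_below_def
    by (intro sum.union_disjoint) auto
  have "S = B \<union> C" unfolding B_def C_def using chain_total[OF S(1) v] le_refl[OF vA] by blast
  moreover have "chain (S' \<union> C)"
    unfolding C_def by (rule replace_chain_below[OF S(1) S'(1)])
  ultimately have "start v \<le> sum len B"
    using chain_len_le[of "S' \<union> C"] sum_Un[OF S'(1)] sum_Un[OF B] S(2) S'(2) by simp
  then have "start v = sum len B" using start_ge[OF B] by simp
  moreover have "{u \<in> S. (u, v) \<in> r} = insert v B" unfolding B_def using v le_refl[OF vA] by blast
  ultimately show ?thesis using sum_len_insert_below[OF B] by simp
qed

lemma tight_chain_start_le:
  assumes S: "chain S" "sum len S = L" and v: "v \<in> S" and "0 \<le> \<tau>"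
    and before: "\<And>u. u \<in> S \<Longrightarrow> (u, v) \<in> r \<Longrightarrow> u \<noteq> v \<Longrightarrow> start u + len u \<le> \<tau>"
  shows "start v \<le> \<tau>"
proof -
  define B where "B = {u \<in> S. (u, v) \<in> r \<and> u \<noteq> v}"
  have vA: "v \<in> A" using S(1) v unfolding chain_iff by blast
  have "B \<in> chains_below v" using S(1) unfolding B_def chains_below_def chain_iff by blast
  moreover have "{u \<in> S. (u, v) \<in> r} = insert v B" unfolding B_def using v le_refl[OF vA] by blast
  ultimately have start: "start v = sum len B"
    using tight_chain_end[OF S v] sum_len_insert_below by simp
  show ?thesis
  proof (cases "B = {}")
    case True
    then show ?thesis using start assms(4) by simp
  next
    case False
    have "finite B" using finite_chain[OF S(1)] unfolding B_def by simp
    then obtain p where p: "p \<in> B" "\<And>u. u \<in> B \<Longrightarrow> (u, p) \<in> r"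
      using finite_chain_has_maximum[OF partial_order _ False] chain_total[OF S(1)]
      unfolding B_def by blast
    then have "{u \<in> S. (u, p) \<in> r} = B" using le_trans le_antisym unfolding B_def by blast
    then have "start p + len p = start v"
      using tight_chain_end[OF S, of p] p(1) start unfolding B_def by simp
    then show ?thesis using before[of p] p(1) unfolding B_def by simp
  qed
qed

lemma tight_chain_covers_once:
  assumes S: "chain S" "sum len S = L" and \<tau>: "0 \<le> \<tau>" "\<tau> < L"
  shows "\<exists>!v. v \<in> S \<and> start v \<le> \<tau> \<and> \<tau> < start v + len v"
proof -
  have finS: "finite S" "S \<noteq> {}" using finite_chain[OF S(1)] S(2) \<tau> by auto
  obtain m where m: "m \<in> S" "\<And>u. u \<in> S \<Longrightarrow> (u, m) \<in> r"
    using finite_chain_has_maximum[OF partial_order finS chain_total[OF S(1)]] by blast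
  then have "{u \<in> S. (u, m) \<in> r} = S" by blast
  then have "m \<in> {v \<in> S. \<tau> < start v + len v}"
    using tight_chain_end[OF S m(1)] m(1) S(2) \<tau>(2) by simp
  then obtain v where "minimal_in r {v \<in> S. \<tau> < start v + len v} v"
    using exists_minimal_in[OF _ partial_order, of "{v \<in> S. \<tau> < start v + len v}"] finS(1) by auto
  then have v: "v \<in> S" "\<tau> < start v + len v"
    "\<And>u. u \<in> S \<Longrightarrow> (u, v) \<in> r \<Longrightarrow> u \<noteq> v \<Longrightarrow> start u + len u \<le> \<tau>"
    unfolding minimal_in_def by force+
  have "start v \<le> \<tau>" using tight_chain_start_le[OF S v(1) \<tau>(1) v(3)] by blast
  moreover have "u = v" if "u \<in> S" "start u \<le> \<tau>" "\<tau> < start u + len u" for u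
    using that v(1,2) \<open>start v \<le> \<tau>\<close> chain_total[OF S(1) that(1) v(1)]
      end_le_start[of u v] end_le_start[of v u] by fastforce
  ultimately show ?thesis using v(1,2) by blast
qed

end


section \<open>Rounding to unit fractions\<close>

definition unit_fraction_above :: "real \<Rightarrow> real" where
  "unit_fraction_above y = 1 / of_int \<lfloor>1 / y\<rfloor>"

definition round_unit :: "real \<Rightarrow> real" where
  "round_unit y = (if y \<le> 1 / 2 then unit_fraction_above y else 1 - unit_fraction_above (1 - y))"

text \<open>Division by zero gives \<open>unit_fraction_above 0 = 0\<close>, hence \<open>round_unit 1 = 1\<close>.\<close>

lemma floor_inverse_ge_2:
  fixes y :: real
  assumes "0 < y" "y \<le> 1 / 2"
  shows "2 \<le> \<lfloor>1 / y\<rfloor>"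
  using assms by (simp add: le_floor_iff field_simps)

lemma unit_fraction_above_pos:
  assumes "0 < y" "y \<le> 1 / 2"
  shows "0 < unit_fraction_above y"
  using floor_inverse_ge_2[OF assms] by (simp add: unit_fraction_above_def)

lemma unit_fraction_above_mono:
  assumes "0 \<le> u" "u \<le> v" "v \<le> 1 / 2"
  shows "unit_fraction_above u \<le> unit_fraction_above v"
proof (cases "u = 0")
  case True
  then show ?thesis
    using unit_fraction_above_pos[of v] assms
    by (cases "v = 0") (auto simp: unit_fraction_above_def)
next
  case False
  then have "\<lfloor>1 / v\<rfloor> \<le> \<lfloor>1 / u\<rfloor>" using assms by (intro floor_mono) (simp add: frac_le)
  then show ?thesis
    using floor_inverse_ge_2[of v] False assms
    unfolding unit_fraction_above_def by (intro divide_left_mono) auto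
qed

lemma unit_fraction_above_le_half:
  assumes "0 \<le> y" "y \<le> 1 / 2"
  shows "unit_fraction_above y \<le> 1 / 2"
  using unit_fraction_above_mono[OF assms order_refl] by (simp add: unit_fraction_above_def)

lemma round_unit_pos:
  assumes "0 < y" "y \<le> 1"
  shows "0 < round_unit y"
  using assms unit_fraction_above_pos[of y] unit_fraction_above_le_half[of "1 - y"]
  by (auto simp: round_unit_def)

lemma round_unit_le_1:
  assumes "0 \<le> y" "y \<le> 1"
  shows "round_unit y \<le> 1"
  using assms unit_fraction_above_mono[of 0 "1 - y"] unit_fraction_above_le_half[of y]
  by (auto simp: round_unit_def unit_fraction_above_def[of 0])

lemma round_unit_1: "round_unit 1 = 1"
  by (simp add: round_unit_def unit_fraction_above_def)

lemma round_unit_sum_le_1: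
  assumes "0 \<le> u" "0 \<le> v" "u + v \<le> 1"
  shows "round_unit u + round_unit v \<le> 1"
proof -
  consider "u \<le> 1 / 2" "v \<le> 1 / 2" | "u \<le> 1 / 2" "1 / 2 < v" | "1 / 2 < u" "v \<le> 1 / 2"
    using assms by linarith
  then show ?thesis
  proof cases
    case 1
    then show ?thesis
      using unit_fraction_above_le_half[of u] unit_fraction_above_le_half[of v] assms
      by (simp add: round_unit_def)
  next
    case 2
    then show ?thesis
      using unit_fraction_above_mono[of u "1 - v"] assms by (simp add: round_unit_def)
  next
    case 3
    then show ?thesis
      using unit_fraction_above_mono[of v "1 - u"] assms by (simp add: round_unit_def)
  qed
qed

lemma round_unit_middle:
  assumes "1 / 3 < y" "y < 2 / 3"
  shows "round_unit y = 1 / 2"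
proof -
  have "\<lfloor>1 / z\<rfloor> = 2" if "1 / 3 < z" "z \<le> 1 / 2" for z :: real
    using that by (intro floor_unique) (auto simp: field_simps)
  from this[of y] this[of "1 - y"] show ?thesis
    using assms by (auto simp: round_unit_def unit_fraction_above_def)
qed


section \<open>Numerical estimates\<close>

definition \<gamma> :: real where
  "\<gamma> = (3 * log 2 3 - 2) / log 2 3"

definition \<beta> :: real where
  "\<beta> = 2 powr (1 / \<gamma>)"

lemma log_2_3_ge: "19 / 12 \<le> log 2 (3 :: real)"
proof -
  have "log 2 ((2 :: real) ^ 19) \<le> log 2 (3 ^ 12)" by simp
  moreover have "log 2 ((2 :: real) ^ 19) = 19" by (subst log_nat_power) auto
  moreover have "log 2 ((3 :: real) ^ 12) = 12 * log 2 3" by (subst log_nat_power) auto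
  ultimately show ?thesis by linarith
qed

text \<open>The convergent \<open>19 / 12\<close> of \<open>log 2 3\<close> gives a bound on \<open>\<gamma>\<close> that is sharp enough for everything
  except \<open>powr_inverse_\<gamma>_27_4\<close>.\<close>

lemma \<gamma>_bounds: "33 / 19 \<le> \<gamma>" "\<gamma> \<le> 2"
proof -
  have \<gamma>: "\<gamma> = 3 - 2 / log 2 3" using log_2_3_ge by (simp add: \<gamma>_def field_simps)
  have "2 / log 2 3 \<le> 2 / (19 / 12 :: real)" using log_2_3_ge by (intro divide_left_mono) auto
  then show "33 / 19 \<le> \<gamma>" unfolding \<gamma> by simp
  have "log 2 (3 :: real) \<le> 2" by (simp add: log_le_iff powr_numeral)
  then have "2 / 2 \<le> 2 / log 2 (3 :: real)" using log_2_3_ge by (intro divide_left_mono) auto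
  then show "\<gamma> \<le> 2" unfolding \<gamma> by simp
qed

lemma powr_inverse_\<gamma>_27_4: "(27 / 4) powr (1 / \<gamma>) = 3"
proof -
  have "ln (27 / 4 :: real) = ln (3 ^ 3) - ln (2 ^ 2)" by (simp add: ln_div)
  also have "\<dots> = 3 * ln 3 - 2 * ln 2" by (simp only: ln_realpow)
  also have "\<dots> = \<gamma> * ln 3" by (simp add: \<gamma>_def log_def field_simps)
  finally show ?thesis using \<gamma>_bounds(1) by (simp add: powr_def)
qed

lemma powr_inverse_\<gamma>_le:
  fixes q V :: real
  assumes "1 \<le> q" "0 < V" "V ^ 19 \<le> q ^ 33"
  shows "V powr (1 / \<gamma>) \<le> q"
proof -
  have "19 * ln V \<le> 33 * ln q" using ln_mono[OF assms(3)] assms by (simp add: ln_realpow)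
  moreover have "(33 / 19) * ln q \<le> \<gamma> * ln q" using assms \<gamma>_bounds by (intro mult_right_mono) auto
  ultimately have "ln V / \<gamma> \<le> ln q" using \<gamma>_bounds(1) by (simp add: field_simps)
  then have "exp (ln V / \<gamma>) \<le> exp (ln q)" by simp
  then show ?thesis using assms by (simp add: powr_def)
qed

lemma powr_inverse_\<gamma>_le_of_linear:
  fixes q V d :: real and q\<^sub>0 :: nat
  assumes "1 \<le> q" "0 < V" "0 < d" "V \<le> d * q" "d ^ 19 \<le> real q\<^sub>0 ^ 14" "real q\<^sub>0 \<le> q"
  shows "V powr (1 / \<gamma>) \<le> q"
proof (rule powr_inverse_\<gamma>_le[OF assms(1,2)])
  have "V ^ 19 \<le> d ^ 19 * q ^ 19"
    using power_mono[OF assms(4)] assms(2) by (simp add: power_mult_distrib)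
  also have "\<dots> \<le> q ^ 14 * q ^ 19"
    using order_trans[OF assms(5) power_mono[OF assms(6)]] assms(1) by (intro mult_right_mono) auto
  also have "\<dots> = q ^ 33" by (simp flip: power_add)
  finally show "V ^ 19 \<le> q ^ 33" .
qed

lemma powr_mult_power:
  fixes y z p :: real
  assumes "0 < y" "0 < z"
  shows "y powr p * (z powr p) ^ m = (y * z ^ m) powr p"
  using assms by (induction m) (auto simp: powr_mult)

lemma \<beta>_power_mult_powr:
  assumes "0 < V"
  shows "\<beta> ^ k * V powr (1 / \<gamma>) = (2 ^ k * V) powr (1 / \<gamma>)"
  unfolding \<beta>_def using powr_mult_power[OF assms, of 2] by (simp add: mult.commute)

lemma \<beta>_ge_1: "1 \<le> \<beta>"
  unfolding \<beta>_def using \<gamma>_bounds by (intro ge_one_powr_ge_zero) auto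

lemma \<beta>_power_le:
  assumes "1 \<le> q" "2 ^ (k * 19) \<le> q ^ 33"
  shows "\<beta> ^ k \<le> q"
  using powr_inverse_\<gamma>_le[of q "2 ^ k"] \<beta>_power_mult_powr[of 1 k] assms by (simp add: power_mult)

lemma \<beta>_power_bounds:
  "\<beta>^2 \<le> 223 / 100" "\<beta>^3 \<le> 10 / 3" "\<beta>^4 \<le> 5" "\<beta>^5 \<le> 8" "\<beta>^6 \<le> 11" "\<beta>^7 \<le> 19" "\<beta>^8 \<le> 26" "\<beta>^9 \<le> 45"
  by (rule \<beta>_power_le; simp add: power_divide)+

lemma one_plus_inverse_power_le:
  assumes "0 < k"
  shows "(real (Suc k) / real k) ^ k \<le> 272 / 100"
proof -
  have "(real (Suc k) / real k) ^ k \<le> exp (1 / real k) ^ k"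
    using exp_ge_add_one_self[of "1 / real k"] assms
    by (intro power_mono) (auto simp: field_simps)
  also have "\<dots> = exp 1" using assms by (simp flip: exp_of_nat_mult)
  also have "\<dots> \<le> 272 / 100" using e_less_272 by simp
  finally show ?thesis .
qed

text \<open>What the weight \<open>w\<close> of a star with \<open>m\<close> leaves has to satisfy if the star contributes \<open>m + 1\<close>
  extensions, and if \<open>\<beta>\<^sup>2\<close> or \<open>\<beta>\<^sup>4\<close> is to be paid in addition for pairs next to the star.\<close>

definition star_weight_bound :: "nat \<Rightarrow> real \<Rightarrow> bool" where
  "star_weight_bound m w \<longleftrightarrow>
    w \<le> real m + 1 \<and> \<beta>^2 * w \<le> 2 * real m + 3 \<and> \<beta>^4 * w \<le> 4 * real m + 8"

lemma star_weight_bound_powr: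
  assumes "0 < V" "V powr (1 / \<gamma>) \<le> real m + 1"
    "(4 * V) powr (1 / \<gamma>) \<le> 2 * real m + 3" "(16 * V) powr (1 / \<gamma>) \<le> 4 * real m + 8"
  shows "star_weight_bound m (V powr (1 / \<gamma>))"
  using assms unfolding star_weight_bound_def by (simp add: \<beta>_power_mult_powr)

text \<open>The product of the inverse rounded values over a star whose centre has the value \<open>1 / K\<close> and
  whose \<open>m\<close> leaves have the value \<open>1 - 1 / K\<close>.\<close>

definition star_product :: "nat \<Rightarrow> nat \<Rightarrow> real" where
  "star_product K m = real K * (real K / (real K - 1)) ^ m"

lemma star_product_pos: "3 \<le> K \<Longrightarrow> 0 < star_product K m"
  by (simp add: star_product_def)

lemma star_product_le:
  assumes "5 \<le> m" "m = K - 1 \<or> m = K"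
  shows "star_product K m \<le> 272 / 100 * (real m + 5 / 4)"
  using assms(2)
proof
  assume "m = K - 1"
  then have K: "K = Suc m" using assms(1) by simp
  have "star_product K m = (real m + 1) * (real (Suc m) / real m) ^ m"
    unfolding K star_product_def by (simp add: add.commute)
  also have "\<dots> \<le> (real m + 1) * (272 / 100)"
    using one_plus_inverse_power_le[of m] assms(1) by (intro mult_left_mono) auto
  finally show ?thesis by simp
next
  assume "m = K"
  define k where "k = m - 1"
  have K: "K = Suc k" "m = Suc k" "4 \<le> k" using \<open>m = K\<close> assms(1) unfolding k_def by auto
  have "star_product K m = (real (Suc k) * (real (Suc k) / real k)) * (real (Suc k) / real k) ^ k"
    unfolding K star_product_def by (simp add: add.commute)
  also have "\<dots> \<le> (real (Suc k) * (real (Suc k) / real k)) * (272 / 100)"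
    using one_plus_inverse_power_le[of k] K by (intro mult_left_mono) auto
  also have "real (Suc k) * (real (Suc k) / real k) \<le> real m + 5 / 4"
    using K by (simp add: field_simps)
  finally show ?thesis by simp
qed

lemma star_weight_bound_large:
  assumes "5 \<le> m" "m = K - 1 \<or> m = K"
  shows "star_weight_bound m (star_product K m powr (1 / \<gamma>))"
proof (rule star_weight_bound_powr)
  show V: "0 < star_product K m" using assms by (intro star_product_pos) auto
  note le = star_product_le[OF assms]
  show "star_product K m powr (1 / \<gamma>) \<le> real m + 1"
    using V le assms(1) by (intro powr_inverse_\<gamma>_le_of_linear[where d = 3 and q\<^sub>0 = 6]) auto
  show "(4 * star_product K m) powr (1 / \<gamma>) \<le> 2 * real m + 3"
    using V le assms(1) by (intro powr_inverse_\<gamma>_le_of_linear[where d = 6 and q\<^sub>0 = 13]) auto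
  show "(16 * star_product K m) powr (1 / \<gamma>) \<le> 4 * real m + 8"
    using V le assms(1) by (intro powr_inverse_\<gamma>_le_of_linear[where d = 11 and q\<^sub>0 = 28]) auto
qed

lemma star_weight_bound_small:
  "star_weight_bound 2 (star_product 3 2 powr (1 / \<gamma>))"
  "star_weight_bound 3 (star_product 3 3 powr (1 / \<gamma>))"
  "star_weight_bound 3 (star_product 4 3 powr (1 / \<gamma>))"
  "star_weight_bound 4 (star_product 4 4 powr (1 / \<gamma>))"
  "star_weight_bound 4 (star_product 5 4 powr (1 / \<gamma>))"
proof -
  have product: "star_product 3 2 = 27 / 4" "star_product 3 3 = 81 / 8"
    "star_product 4 3 = 256 / 27" "star_product 4 4 = 1024 / 81" "star_product 5 4 = 3125 / 256"
    by (simp_all add: star_product_def power_divide)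
  show "star_weight_bound 2 (star_product 3 2 powr (1 / \<gamma>))"
    unfolding product
    by (rule star_weight_bound_powr)
      (simp_all add: powr_inverse_\<gamma>_27_4 powr_inverse_\<gamma>_le power_divide)
  show "star_weight_bound 3 (star_product 3 3 powr (1 / \<gamma>))"
    "star_weight_bound 3 (star_product 4 3 powr (1 / \<gamma>))"
    "star_weight_bound 4 (star_product 4 4 powr (1 / \<gamma>))"
    "star_weight_bound 4 (star_product 5 4 powr (1 / \<gamma>))"
    unfolding product
    by (rule star_weight_bound_powr; (rule powr_inverse_\<gamma>_le)?; simp add: power_divide)+
qed

lemma star_weight_bound_star_product:
  assumes "3 \<le> K" "m = K - 1 \<or> m = K"
  shows "star_weight_bound m (star_product K m powr (1 / \<gamma>))"
proof -
  consider "K = 3" "m = 2" | "K = 3" "m = 3" | "K = 4" "m = 3" | "K = 4" "m = 4"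
    | "K = 5" "m = 4" | "5 \<le> m"
    using assms by linarith
  then show ?thesis
    using star_weight_bound_small star_weight_bound_large[OF _ assms(2)] by cases simp_all
qed


section \<open>Interval layouts of posets of width two\<close>

locale interval_layout = finite_poset +
  fixes x s :: "'a \<Rightarrow> real" and L :: real
  assumes antichain_card_le_2: "antichain A r S \<Longrightarrow> card S \<le> 2"
    and x_pos: "v \<in> A \<Longrightarrow> 0 < x v"
    and incomparable_sum_le_1: "(u, v) \<in> incomparability A r \<Longrightarrow> x u + x v \<le> 1"
    and s_nonneg: "v \<in> A \<Longrightarrow> 0 \<le> s v"
    and end_le_L: "v \<in> A \<Longrightarrow> s v + 1 / x v \<le> L"
    and end_le_start: "(u, v) \<in> r \<Longrightarrow> u \<noteq> v \<Longrightarrow> s u + 1 / x u \<le> s v"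
    and coverage: "0 \<le> \<tau> \<Longrightarrow> \<tau> < L \<Longrightarrow> (\<Sum>v | v \<in> A \<and> s v \<le> \<tau> \<and> \<tau> < s v + 1 / x v. x v) = 1"
begin

definition t :: "'a \<Rightarrow> real" where
  "t v = s v + 1 / x v"

definition active :: "real \<Rightarrow> 'a \<Rightarrow> bool" where
  "active \<tau> v \<longleftrightarrow> v \<in> A \<and> s v \<le> \<tau> \<and> \<tau> < t v"

definition active_pair :: "real \<Rightarrow> 'a \<Rightarrow> 'a \<Rightarrow> bool" where
  "active_pair \<tau> u v \<longleftrightarrow> active \<tau> u \<and> active \<tau> v \<and> u \<noteq> v"

definition cut :: "real \<Rightarrow> bool" where
  "cut T \<longleftrightarrow> (\<forall>v\<in>A. \<not> (s v < T \<and> T < t v))"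

definition rest :: "real \<Rightarrow> 'a set" where
  "rest \<tau> = {v \<in> A. \<tau> < t v}"

definition num_ext :: "real \<Rightarrow> real" where
  "num_ext \<tau> = real (num_linear_extensions r (rest \<tau>))"

definition num_ext_without :: "real \<Rightarrow> 'a \<Rightarrow> real" where
  "num_ext_without \<tau> v = real (num_linear_extensions r (rest \<tau> - {v}))"

definition on_isolated_edge :: "'a \<Rightarrow> bool" where
  "on_isolated_edge v \<longleftrightarrow> (\<exists>u. v \<parallel> u \<and> (\<forall>w. v \<parallel> w \<longrightarrow> w = u) \<and> (\<forall>w. u \<parallel> w \<longrightarrow> w = v))"

lemma t_le_L: "v \<in> A \<Longrightarrow> t v \<le> L"
  unfolding t_def by (rule end_le_L)

lemma t_le_s: "(u, v) \<in> r \<Longrightarrow> u \<noteq> v \<Longrightarrow> t u \<le> s v"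
  unfolding t_def by (rule end_le_start)

lemma s_less_t: "v \<in> A \<Longrightarrow> s v < t v"
  using x_pos[of v] by (simp add: t_def)

lemma no_antichain_3: "u \<parallel> v \<Longrightarrow> v \<parallel> w \<Longrightarrow> u \<parallel> w \<Longrightarrow> False"
  using antichain_card_le_2[of "{u, v, w}"] by (auto simp: antichain_def incomparability_def)

lemma x_less_1: "u \<parallel> v \<Longrightarrow> x u < 1"
  using incomparable_sum_le_1[of u v] x_pos[of v] incomparable_mem[of u v] by linarith

lemma active_mem: "active \<tau> v \<Longrightarrow> v \<in> A \<and> s v \<le> \<tau> \<and> \<tau> < t v"
  by (simp add: active_def)

lemma active_range: "active \<tau> v \<Longrightarrow> 0 \<le> \<tau> \<and> \<tau> < L"
  using s_nonneg t_le_L active_mem by (meson order.trans order_less_le_trans)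

lemma active_start: "v \<in> A \<Longrightarrow> active (s v) v"
  using s_less_t by (simp add: active_def)

lemma active_pair_commute: "active_pair \<tau> u v \<Longrightarrow> active_pair \<tau> v u"
  by (auto simp: active_pair_def)

lemma active_pair_mem: "active_pair \<tau> u v \<Longrightarrow> u \<in> A \<and> v \<in> A \<and> u \<noteq> v"
  by (auto simp: active_pair_def active_def)

lemma active_pair_incomparable:
  assumes "active_pair \<tau> u v"
  shows "u \<parallel> v"
proof -
  have "(u, v) \<notin> r" "(v, u) \<notin> r"
    using assms t_le_s[of u v] t_le_s[of v u] by (auto simp: active_pair_def active_def)
  then show ?thesis using active_pair_mem[OF assms] by (auto simp: incomparability_def)
qed

lemma active_pair_exhausts:
  assumes "active_pair \<tau> a b" "active \<tau> c"
  shows "c = a \<or> c = b"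
proof (rule ccontr)
  assume "\<not> ?thesis"
  then have "active_pair \<tau> b c" "active_pair \<tau> a c" using assms by (auto simp: active_pair_def)
  then show False using no_antichain_3 active_pair_incomparable assms(1) by blast
qed

lemma active_cases:
  assumes "0 \<le> \<tau>" "\<tau> < L"
  obtains (single) u where "active \<tau> u" "x u = 1" "\<And>v. active \<tau> v \<Longrightarrow> v = u"
  | (pair) u v where "active_pair \<tau> u v"
proof -
  have sum: "sum x {v. active \<tau> v} = 1"
    using coverage[OF assms] by (simp add: active_def t_def)
  then have "{v. active \<tau> v} \<noteq> {}" by (metis sum.empty zero_neq_one)
  then obtain u where u: "active \<tau> u" by blast
  show thesis
  proof (cases "\<exists>v. active \<tau> v \<and> v \<noteq> u")
    case True
    then show thesis using pair[of u] u by (auto simp: active_pair_def)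
  next
    case False
    then have "{v. active \<tau> v} = {u}" using u by blast
    then have "x u = 1" using sum by simp
    then show thesis using single[of u] u False by blast
  qed
qed

lemma active_pair_sum:
  assumes "active_pair \<tau> a b"
  shows "x a + x b = 1"
proof -
  have "{v \<in> A. s v \<le> \<tau> \<and> \<tau> < s v + 1 / x v} = {a, b}"
    using assms active_pair_exhausts[OF assms] by (auto simp: active_pair_def active_def t_def)
  moreover have "0 \<le> \<tau>" "\<tau> < L" using active_range assms by (auto simp: active_pair_def)
  ultimately show ?thesis using coverage[of \<tau>] active_pair_mem[OF assms] by simp
qed

lemma active_partner:
  assumes "active \<tau> a" "x a < 1"
  obtains b where "active_pair \<tau> a b"
proof -
  have "0 \<le> \<tau>" "\<tau> < L" using active_range assms(1) by auto
  then show thesis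
  proof (cases rule: active_cases)
    case (single u)
    then show ?thesis using assms by fastforce
  next
    case (pair u v)
    then show ?thesis using that[of u] that[of v] assms(1) by (auto simp: active_pair_def)
  qed
qed

lemma x_le_1:
  assumes "v \<in> A"
  shows "x v \<le> 1"
proof (rule ccontr)
  assume "\<not> x v \<le> 1"
  have "0 \<le> s v" "s v < L"
    using active_range[OF active_start[OF assms]] by auto
  then show False
  proof (cases rule: active_cases)
    case (single u)
    then show ?thesis using active_start[OF assms] \<open>\<not> x v \<le> 1\<close> by force
  next
    case (pair u w)
    then show ?thesis
      using active_pair_exhausts[OF pair active_start[OF assms]] active_pair_sum[OF pair]
        active_pair_mem[OF pair] x_pos[of u] x_pos[of w] \<open>\<not> x v \<le> 1\<close> by auto
  qed
qed

lemma active_overlap: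
  assumes "active \<tau> a" "v \<in> A" "s v < t a" "\<tau> < t v"
  shows "active (max \<tau> (s v)) a" "active (max \<tau> (s v)) v"
  using assms s_less_t[of v] by (auto simp: active_def max_def)

lemma active_pair_overlap:
  assumes "active_pair \<tau> a b" "v \<in> A" "s v < t a" "s v < t b" "\<tau> < t v"
  shows "v = a \<or> v = b"
proof -
  have "active \<tau> a" "active \<tau> b" "a \<noteq> b" using assms(1) by (auto simp: active_pair_def)
  then have "active_pair (max \<tau> (s v)) a b" "active (max \<tau> (s v)) v"
    using assms active_overlap unfolding active_pair_def by blast+
  then show ?thesis by (rule active_pair_exhausts)
qed

lemma active_full_overlap:
  assumes "active \<tau> u" "x u = 1" "v \<in> A" "s v < t u" "\<tau> < t v"
  shows "v = u"
proof (rule ccontr)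
  assume "v \<noteq> u"
  then have "u \<parallel> v"
    using active_overlap[OF assms(1,3-5)] active_pair_incomparable
    unfolding active_pair_def by blast
  then show False using x_less_1 assms(2) by force
qed

lemma same_end_active_pair:
  assumes "a \<in> A" "c \<in> A" "t c = t a" "c \<noteq> a"
  shows "active_pair (max (s a) (s c)) a c"
  using active_overlap[OF active_start[OF assms(1)] assms(2)] s_less_t[of a] s_less_t[of c] assms
  unfolding active_pair_def by simp

lemma next_partner:
  assumes "active_pair \<tau> a b" "t b < t a"
  obtains b' where "active_pair (t b) a b'" "s b' = t b" "x b' = x b"
proof -
  have mem: "a \<in> A" "b \<in> A" "s a \<le> \<tau>" "s b \<le> \<tau>" "\<tau> < t b"
    using assms(1) by (auto simp: active_pair_def active_def)
  have "active (t b) a" using mem assms(2) by (auto simp: active_def)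
  moreover have "x a < 1" using active_pair_incomparable[OF assms(1)] by (rule x_less_1)
  ultimately obtain b' where b': "active_pair (t b) a b'" using active_partner by blast
  then have b'_mem: "b' \<in> A" "b' \<noteq> a" "s b' \<le> t b" "t b < t b'"
    by (auto simp: active_pair_def active_def)
  have "s b' = t b"
  proof (rule ccontr)
    assume "s b' \<noteq> t b"
    then have "b' = a \<or> b' = b"
      using active_pair_overlap[OF assms(1), of b'] b'_mem assms(2) mem(5) by linarith
    then show False using b'_mem by auto
  qed
  moreover have "x b' = x b" using active_pair_sum[OF assms(1)] active_pair_sum[OF b'] by simp
  ultimately show thesis using that b' by blast
qed

subsection \<open>The remaining elements\<close>

lemma rest_subset: "rest \<tau> \<subseteq> A"
  by (auto simp: rest_def)

lemma finite_rest: "finite (rest \<tau>)"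
  using rest_subset finite_A by (rule finite_subset)

lemma active_in_rest: "active \<tau> v \<Longrightarrow> v \<in> rest \<tau>"
  by (simp add: active_def rest_def)

lemma rest_mono: "\<tau> \<le> \<tau>' \<Longrightarrow> rest \<tau>' \<subseteq> rest \<tau>"
  by (auto simp: rest_def)

lemma rest_induct [case_names less]:
  assumes "\<And>\<sigma>. (\<And>v. v \<in> rest \<sigma> \<Longrightarrow> P (t v)) \<Longrightarrow> P \<sigma>"
  shows "P \<sigma>"
proof (induction "card (rest \<sigma>)" arbitrary: \<sigma> rule: less_induct)
  case less
  have "card (rest (t v)) < card (rest \<sigma>)" if "v \<in> rest \<sigma>" for v
    using that finite_rest by (intro psubset_card_mono) (auto simp: rest_def)
  then show ?case using less assms by blast
qed

lemma up_closed_rest: "up_closed A r (rest \<tau>)"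
  unfolding up_closed_def
proof (intro conjI ballI impI rest_subset)
  fix u v assume "u \<in> rest \<tau>" "v \<in> A" "(u, v) \<in> r"
  then show "v \<in> rest \<tau>"
    using t_le_s[of u v] s_less_t[of v] by (cases "u = v") (auto simp: rest_def)
qed

lemma active_minimal: "active \<tau> u \<Longrightarrow> minimal_in r (rest \<tau>) u"
  unfolding minimal_in_def rest_def using t_le_s active_mem by fastforce

lemma rest_end_subset: "active \<tau> a \<Longrightarrow> rest (t a) \<subseteq> rest \<tau> - {a}"
  by (auto simp: rest_def active_def)

lemma num_ext_nonneg: "0 \<le> num_ext \<tau>"
  by (simp add: num_ext_def)

lemma num_ext_mono: "\<tau> \<le> \<tau>' \<Longrightarrow> num_ext \<tau>' \<le> num_ext \<tau>"
  unfolding num_ext_def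
  using num_linear_extensions_mono[OF finite_A partial_order up_closed_rest rest_mono rest_subset]
  by simp

lemma num_ext_end_le:
  assumes "active \<tau> a"
  shows "num_ext (t a) \<le> num_ext_without \<tau> a"
  unfolding num_ext_def num_ext_without_def
  using num_linear_extensions_mono[OF finite_A partial_order up_closed_rest
      rest_end_subset[OF assms] subset_trans[OF Diff_subset rest_subset]] by simp

lemma num_ext_branch:
  assumes "active_pair \<tau> a b"
  shows "num_ext (t a) + num_ext (t b) \<le> num_ext \<tau>"
proof -
  have ab: "active \<tau> a" "active \<tau> b" "a \<noteq> b" using assms by (auto simp: active_pair_def)
  have "num_linear_extensions r (rest (t a)) + num_linear_extensions r (rest (t b))
      \<le> num_linear_extensions r (rest \<tau>)"
    using rest_end_subset ab
    by (intro num_linear_extensions_branch[OF finite_A partial_order rest_subset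
          active_minimal active_minimal _ up_closed_rest _ up_closed_rest])
  then show ?thesis unfolding num_ext_def by linarith
qed

lemma end_notin_rest: "v \<notin> rest (t v)"
  by (simp add: rest_def)

lemma rest_first_end:
  assumes "active_pair \<tau> a b" "t b < t a"
  shows "rest \<tau> = insert b (rest (t b))"
proof -
  have "t b < t v" if "v \<in> A" "\<tau> < t v" "v \<noteq> b" for v
    using active_pair_overlap[OF assms(1) that(1)] that s_less_t[OF that(1)] assms(2) by fastforce
  then show ?thesis using assms by (auto simp: rest_def active_pair_def active_def)
qed

lemma rest_tie:
  assumes "active_pair \<tau> a b" "t b = t a"
  shows "rest \<tau> = insert a (insert b (rest (t a)))"
proof -
  have "t a < t v" if "v \<in> A" "\<tau> < t v" "v \<noteq> a" "v \<noteq> b" for v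
    using active_pair_overlap[OF assms(1) that(1)] that s_less_t[OF that(1)] assms(2) by fastforce
  then show ?thesis using assms by (auto simp: rest_def active_pair_def active_def)
qed

lemma rest_full:
  assumes "active \<tau> u" "x u = 1"
  shows "rest \<tau> = insert u (rest (t u))"
proof -
  have "t u < t v" if "v \<in> A" "\<tau> < t v" "v \<noteq> u" for v
    using active_full_overlap[OF assms that(1)] that s_less_t[OF that(1)] by fastforce
  then show ?thesis using assms(1) by (auto simp: rest_def active_def)
qed

subsection \<open>Cuts\<close>

lemma tie_cut:
  assumes "active_pair \<tau> a b" "t b = t a"
  shows "cut (t a)"
  unfolding cut_def
proof (intro ballI notI)
  fix v assume v: "v \<in> A" "s v < t a \<and> t a < t v"
  have "\<tau> < t a" using assms(1) by (simp add: active_pair_def active_def)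
  then have "v = a \<or> v = b" using active_pair_overlap[OF assms(1) v(1)] v(2) assms(2) by simp
  then show False using v assms(2) by auto
qed

lemma full_cut:
  assumes "active \<tau> u" "x u = 1"
  shows "cut (t u)"
  unfolding cut_def
proof (intro ballI notI)
  fix v assume v: "v \<in> A" "s v < t u \<and> t u < t v"
  then have "v = u" using active_full_overlap[OF assms v(1)] assms(1) by (simp add: active_def)
  then show False using v by auto
qed

lemma cut_active_start: "cut T \<Longrightarrow> active T v \<Longrightarrow> s v = T"
  unfolding cut_def active_def by force

lemma active_before_cut:
  assumes "cut T" "0 < T"
  obtains \<tau> where "0 \<le> \<tau>" "\<tau> < T" "\<And>c. active \<tau> c \<Longrightarrow> t c = T"
proof -
  define ends where "ends = insert 0 {t v | v. v \<in> A \<and> t v < T}"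
  have fin: "finite ends" unfolding ends_def using finite_A by simp
  then have "Max ends \<in> ends" by (rule Max_in) (simp add: ends_def)
  then have "Max ends < T" using assms(2) unfolding ends_def by auto
  moreover have "0 \<le> Max ends" using fin by (intro Max_ge) (auto simp: ends_def)
  moreover have "t c = T" if c: "active (Max ends) c" for c
  proof (rule ccontr)
    assume "t c \<noteq> T"
    moreover have "\<not> (s c < T \<and> T < t c)" using assms(1) c unfolding cut_def active_def by blast
    ultimately have "t c < T" using c \<open>Max ends < T\<close> by (auto simp: active_def)
    then have "t c \<le> Max ends" using fin c by (intro Max_ge) (auto simp: active_def ends_def)
    then show False using c by (simp add: active_def)
  qed
  ultimately show thesis using that by blast
qed

lemma incomparable_crosses:
  assumes "p \<parallel> q" "0 \<le> \<tau>" "\<tau> < L"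
  obtains (crossing) c where "active \<tau> c" "p \<parallel> c"
  | (above) c where "active \<tau> c" "c \<noteq> p" "c \<noteq> q" "(p, c) \<in> r" "(q, c) \<in> r"
  | (below) c where "active \<tau> c" "c \<noteq> p" "c \<noteq> q" "(c, p) \<in> r" "(c, q) \<in> r"
proof -
  have "\<exists>c. active \<tau> c \<and> \<not> c \<parallel> q"
    using assms(2,3)
  proof (cases rule: active_cases)
    case (single u)
    have "\<not> u \<parallel> q" using x_less_1[of u q] single(2) by auto
    then show ?thesis using single(1) by blast
  next
    case (pair u w)
    then have "\<not> (u \<parallel> q \<and> w \<parallel> q)" using no_antichain_3 active_pair_incomparable by blast
    then show ?thesis using pair unfolding active_pair_def by blast
  qed
  then obtain c where c: "active \<tau> c" "\<not> c \<parallel> q" by blast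
  show thesis
  proof (cases "p \<parallel> c")
    case False
    have mem: "p \<in> A" "q \<in> A" "c \<in> A"
      using incomparable_mem[OF assms(1)] active_mem[OF c(1)] by auto
    have neq: "c \<noteq> p" "c \<noteq> q" using assms(1) c(2) False by auto
    then have "(p, c) \<in> r \<or> (c, p) \<in> r" "(q, c) \<in> r \<or> (c, q) \<in> r"
      using False c(2) mem by (auto simp: incomparability_def)
    moreover have "\<not> ((p, c) \<in> r \<and> (c, q) \<in> r)" "\<not> ((q, c) \<in> r \<and> (c, p) \<in> r)"
      using incomparable_not_le[OF assms(1)] le_trans by blast+
    ultimately show ?thesis using above below c(1) neq by blast
  qed (use crossing c(1) in blast)
qed

lemma right_crossing:
  assumes "cut T" "a \<parallel> v" "t a \<le> T" "T \<le> s v"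
  obtains c where "active T c" "a \<parallel> c"
proof -
  have mem: "a \<in> A" "v \<in> A" using incomparable_mem[OF assms(2)] by auto
  have "0 \<le> T" "T < L"
    using assms(3,4) s_nonneg[of a] s_less_t[of a] s_less_t[of v] t_le_L[of v] mem by linarith+
  with assms(2) show thesis
  proof (cases rule: incomparable_crosses)
    case (above c)
    then show ?thesis
      using t_le_s[of v c] cut_active_start[OF assms(1) above(1)] s_less_t[of v] mem assms(4)
      by auto
  next
    case (below c)
    then show ?thesis
      using t_le_s[of c a] active_mem[OF below(1)] s_less_t[of a] mem assms(3) by auto
  qed (rule that)
qed

lemma left_crossing:
  assumes "cut T" "v \<parallel> a" "t v \<le> T" "T \<le> s a"
  obtains c where "c \<in> A" "t c = T" "c \<parallel> a"
proof -
  have mem: "a \<in> A" "v \<in> A" using incomparable_mem[OF assms(2)] by auto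
  have "0 < T" using assms(3) s_nonneg[of v] s_less_t[of v] mem by linarith
  then obtain \<tau> where \<tau>: "0 \<le> \<tau>" "\<tau> < T" "\<And>c. active \<tau> c \<Longrightarrow> t c = T"
    using active_before_cut[OF assms(1)] by blast
  have "\<tau> < L" using \<tau>(2) assms(4) s_less_t[of a] t_le_L[of a] mem by linarith
  with incomparable_sym[OF assms(2)] \<tau>(1) show thesis
  proof (cases rule: incomparable_crosses)
    case (crossing c)
    then show ?thesis using that[of c] \<tau>(3) active_mem incomparable_sym by blast
  next
    case (above c)
    then show ?thesis
      using t_le_s[of a c] active_mem[OF above(1)] s_less_t[of a] mem assms(4) \<tau>(2) by auto
  next
    case (below c)
    then show ?thesis
      using t_le_s[of c v] \<tau>(3)[OF below(1)] s_less_t[of v] mem assms(3) by auto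
  qed
qed

text \<open>If \<open>b\<close> comes first, then \<open>a\<close> and \<open>c\<close> are both minimal among the other elements.\<close>

lemma num_ext_crossing_branch:
  assumes "active_pair \<tau> a b" "t b = t a" "active (t a) c" "a \<parallel> c"
  shows "2 * num_ext (t a) + num_ext_without (t a) c \<le> num_ext \<tau>"
proof -
  have ab: "active \<tau> a" "active \<tau> b" "a \<noteq> b" using assms by (auto simp: active_pair_def)
  have min_c: "minimal_in r (rest (t a)) c" using assms(3) by (rule active_minimal)
  have rest: "rest \<tau> - {b} = insert a (rest (t a))"
    using rest_tie[OF assms(1,2)] ab(3) end_notin_rest[of b] assms(2) by auto
  have min_a: "minimal_in r (insert a (rest (t a))) a"
    using active_minimal[OF ab(1)] unfolding rest[symmetric] minimal_in_def using ab(3) by auto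
  have min_c': "minimal_in r (insert a (rest (t a))) c"
    using min_c incomparable_not_le[OF assms(4)] unfolding minimal_in_def by auto
  have "num_linear_extensions r (rest (t a)) + num_linear_extensions r (rest \<tau> - {b})
      \<le> num_linear_extensions r (rest \<tau>)"
    by (rule num_linear_extensions_branch[OF finite_A partial_order rest_subset
          active_minimal[OF ab(1)] active_minimal[OF ab(2)] ab(3)
          up_closed_rest rest_end_subset[OF ab(1)]
          up_closed_remove_minimal[OF up_closed_rest active_minimal[OF ab(2)]] subset_refl])
  moreover have "num_linear_extensions r (rest (t a)) + num_linear_extensions r (rest (t a) - {c})
      \<le> num_linear_extensions r (insert a (rest (t a)))"
    using rest_subset incomparable_mem[OF assms(4)] end_notin_rest
    by (intro num_linear_extensions_branch[OF finite_A partial_order _ min_a min_c'] up_closed_rest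
        up_closed_remove_minimal min_c) auto
  ultimately show ?thesis unfolding num_ext_def num_ext_without_def rest by linarith
qed

subsection \<open>Isolated edges\<close>

lemma isolated_edge_partner:
  assumes "active_pair \<tau> a b" "on_isolated_edge a"
  shows "on_isolated_edge b" "\<And>w. a \<parallel> w \<Longrightarrow> w = b" "\<And>w. b \<parallel> w \<Longrightarrow> w = a"
  using assms(2) active_pair_incomparable[OF assms(1)] incomparable_sym
  unfolding on_isolated_edge_def by metis+

lemma isolated_edge_end_le:
  assumes "active_pair \<tau> a b" "on_isolated_edge a"
  shows "t a \<le> t b"
proof (rule ccontr)
  assume "\<not> t a \<le> t b"
  then obtain b' where "active_pair (t b) a b'" using next_partner[OF assms(1)] by auto
  moreover from this have "b' = b"
    using isolated_edge_partner(2)[OF assms] active_pair_incomparable by blast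
  ultimately show False by (simp add: active_pair_def active_def)
qed

lemma isolated_edge_half:
  assumes "on_isolated_edge a"
  shows "x a = 1 / 2"
proof -
  have a: "a \<in> A" "x a < 1"
    using assms x_less_1 incomparable_mem unfolding on_isolated_edge_def by blast+
  then obtain b where ab: "active_pair (s a) a b" using active_partner[OF active_start] by blast
  note iso = isolated_edge_partner[OF ab assms]
  have b: "b \<in> A" "x b < 1"
    using active_pair_mem[OF ab] x_less_1 active_pair_incomparable[OF active_pair_commute[OF ab]]
    by auto
  then obtain c where c: "active_pair (s b) b c" using active_partner[OF active_start] by blast
  then have "c = a" using iso(3) active_pair_incomparable by blast
  then have "s a = s b" using ab c by (simp add: active_pair_def active_def)
  moreover have "t a = t b"
    using isolated_edge_end_le[OF ab assms]
      isolated_edge_end_le[OF active_pair_commute[OF ab] iso(1)] by simp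
  ultimately have "x a = x b" using x_pos[OF a(1)] x_pos[OF b(1)] by (simp add: t_def)
  then show ?thesis using active_pair_sum[OF ab] by simp
qed

end


section \<open>The lower bound on the number of linear extensions\<close>

context interval_layout
begin

definition wt :: "'a \<Rightarrow> real" where
  "wt v = (if on_isolated_edge v then sqrt 2 else (1 / round_unit (x v)) powr (1 / \<gamma>))"

definition weight :: "real \<Rightarrow> real" where
  "weight \<tau> = prod wt (rest \<tau>)"

lemma round_unit_x_pos: "v \<in> A \<Longrightarrow> 0 < round_unit (x v)"
  using x_pos x_le_1 by (rule round_unit_pos)

lemma wt_pos: "v \<in> A \<Longrightarrow> 0 < wt v"
  using round_unit_x_pos[of v] by (simp add: wt_def)

lemma wt_full: "x v = 1 \<Longrightarrow> wt v = 1"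
  using isolated_edge_half[of v] by (auto simp: wt_def round_unit_1)

lemma wt_isolated_edge: "on_isolated_edge v \<Longrightarrow> wt v = sqrt 2"
  by (simp add: wt_def)

lemma wt_middle: "\<not> on_isolated_edge v \<Longrightarrow> 1 / 3 < x v \<Longrightarrow> x v < 2 / 3 \<Longrightarrow> wt v = \<beta>"
  by (simp add: wt_def round_unit_middle \<beta>_def)

lemma wt_cong: "x u \<noteq> 1 / 2 \<Longrightarrow> x u = x v \<Longrightarrow> wt u = wt v"
  using isolated_edge_half[of u] isolated_edge_half[of v] by (auto simp: wt_def)

lemma weight_pos: "0 < weight \<tau>"
  unfolding weight_def using wt_pos rest_subset by (intro prod_pos) blast

lemma weight_first_end:
  assumes "active_pair \<tau> a b" "t b < t a"
  shows "weight \<tau> = wt b * weight (t b)"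
  unfolding weight_def rest_first_end[OF assms] using finite_rest end_notin_rest by simp

lemma weight_tie:
  assumes "active_pair \<tau> a b" "t b = t a"
  shows "weight \<tau> = wt a * wt b * weight (t a)"
  unfolding weight_def rest_tie[OF assms]
  using active_pair_mem[OF assms(1)] finite_rest end_notin_rest[of a] end_notin_rest[of b] assms(2)
  by simp

lemma weight_full:
  assumes "active \<tau> u" "x u = 1"
  shows "weight \<tau> = weight (t u)"
  unfolding weight_def rest_full[OF assms]
  using finite_rest end_notin_rest wt_full[OF assms(2)] by simp

lemma wt_star:
  assumes "a \<in> A" "x a \<le> 1 / 3" "x b = 1 - x a" and m: "1 / x a - 2 < real m" "real m < 1 / x a"
  shows "star_weight_bound m (wt a * wt b ^ m)"
proof -
  define K where "K = nat \<lfloor>1 / x a\<rfloor>"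
  have "3 \<le> 1 / x a" using x_pos[OF assms(1)] assms(2) by (simp add: field_simps)
  then have "3 \<le> \<lfloor>1 / x a\<rfloor>" by (simp add: le_floor_iff)
  then have K: "3 \<le> K" "real_of_int \<lfloor>1 / x a\<rfloor> = real K" unfolding K_def by linarith+
  then have "real K \<le> 1 / x a" "1 / x a < real K + 1"
    using floor_correct[of "1 / x a"] by linarith+
  then have mK: "m = K - 1 \<or> m = K" using m K(1) by linarith
  have round: "round_unit (x a) = 1 / real K" "round_unit (x b) = 1 - 1 / real K"
    using assms(2,3) K(2) by (simp_all add: round_unit_def unit_fraction_above_def)
  have "1 / round_unit (x a) = real K" "1 / round_unit (x b) = real K / (real K - 1)"
    unfolding round using K(1) by (simp_all add: field_simps)
  then have "wt a = real K powr (1 / \<gamma>)" "wt b = (real K / (real K - 1)) powr (1 / \<gamma>)"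
    using isolated_edge_half[of a] isolated_edge_half[of b] assms(2,3) by (auto simp: wt_def)
  then have "wt a * wt b ^ m = star_product K m powr (1 / \<gamma>)"
    using K(1) by (simp add: star_product_def powr_mult_power)
  then show ?thesis using star_weight_bound_star_product[OF K(1) mK] by simp
qed

subsection \<open>Stars\<close>

text \<open>If another element ends together with \<open>a\<close>, then \<open>t a\<close> is a cut, and \<open>E\<close> accounts for
  extensions gained from incomparabilities across this cut.\<close>

definition tie_bonus :: "'a \<Rightarrow> real \<Rightarrow> bool" where
  "tie_bonus a E \<longleftrightarrow> (E \<noteq> 0 \<longrightarrow> cut (t a)) \<and>
    (\<forall>\<tau> b. active_pair \<tau> a b \<longrightarrow> t b = t a \<longrightarrow> 2 * num_ext (t a) + E \<le> num_ext \<tau>)"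

lemma tie_bonus_0: "tie_bonus a 0"
  unfolding tie_bonus_def using num_ext_branch by fastforce

text \<open>The elements ending while \<open>a\<close> is active are consecutive and have the same length, which
  determines their number \<open>m\<close> up to one; \<open>b\<close> is the first of them to end.\<close>

definition star_of_size :: "'a \<Rightarrow> real \<Rightarrow> real \<Rightarrow> 'a \<Rightarrow> nat \<Rightarrow> bool" where
  "star_of_size a E \<tau> b m \<longleftrightarrow>
    (real m + 1) * num_ext (t a) + E \<le> num_ext \<tau> \<and> weight \<tau> = wt a * wt b ^ m * weight (t a) \<and>
    t b + (real m - 1) * (1 / x b) \<le> t a \<and> t a < t b + real m * (1 / x b)"

lemma star_of_size_0:
  assumes "active_pair \<tau> a b" "tie_bonus a E" "t a < t b"
  shows "star_of_size a E \<tau> b 0"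
proof -
  have ab: "b \<in> A" "s b < t a" "\<tau> < t a" using assms(1) by (auto simp: active_pair_def active_def)
  then have "E = 0" using assms(2,3) unfolding tie_bonus_def cut_def by blast
  moreover have "num_ext (t a) \<le> num_ext \<tau>" using ab(3) by (intro num_ext_mono) simp
  moreover have "t b - 1 / x b < t a" using ab(2) by (simp add: t_def)
  ultimately show ?thesis
    using weight_first_end[OF active_pair_commute[OF assms(1)] assms(3)] assms(3)
    by (auto simp: star_of_size_def)
qed

lemma star_of_size_1:
  assumes "active_pair \<tau> a b" "tie_bonus a E" "t b = t a"
  shows "star_of_size a E \<tau> b 1"
proof -
  have "0 < 1 / x b" using active_pair_mem[OF assms(1)] x_pos by simp
  then show ?thesis
    using assms weight_tie[OF assms(1,3)] by (auto simp: star_of_size_def tie_bonus_def)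
qed

lemma star_of_size_Suc:
  assumes ab: "active_pair \<tau> a b" "t b < t a" and "x a \<noteq> 1 / 2"
    and b': "s b' = t b" "x b' = x b" and m: "star_of_size a E (t b) b' m"
  shows "star_of_size a E \<tau> b (Suc m)"
proof -
  have "num_ext (t a) + num_ext (t b) \<le> num_ext \<tau>" using num_ext_branch[OF ab(1)] .
  then have "(real (Suc m) + 1) * num_ext (t a) + E \<le> num_ext \<tau>"
    using m by (simp add: star_of_size_def algebra_simps)
  moreover have "x b \<noteq> 1 / 2" using active_pair_sum[OF ab(1)] assms(3) by auto
  then have "wt b = wt b'" using b'(2) by (intro wt_cong) auto
  then have "weight \<tau> = wt a * wt b ^ Suc m * weight (t a)"
    using weight_first_end[OF ab] m by (simp add: star_of_size_def)
  moreover have "t b' = t b + 1 / x b" using b' by (simp add: t_def)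
  then have "t b + (real (Suc m) - 1) * (1 / x b) \<le> t a" "t a < t b + real (Suc m) * (1 / x b)"
    using m b'(2)
    by (simp_all add: star_of_size_def algebra_simps add_divide_distrib diff_divide_distrib)
  ultimately show ?thesis by (simp add: star_of_size_def)
qed

lemma exists_star_of_size:
  assumes "active_pair \<tau> a b" "x a \<noteq> 1 / 2" "tie_bonus a E"
  shows "\<exists>m. star_of_size a E \<tau> b m"
  using assms(1)
proof (induction \<tau> arbitrary: b rule: rest_induct)
  case (less \<tau>)
  consider "t a < t b" | "t b = t a" | "t b < t a" by linarith
  then show ?case
  proof cases
    case 3
    obtain b' where b': "active_pair (t b) a b'" "s b' = t b" "x b' = x b"
      using next_partner[OF less.prems 3] .
    have "b \<in> rest \<tau>" using less.prems active_in_rest by (simp add: active_pair_def)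
    then obtain m where "star_of_size a E (t b) b' m" using less.IH b'(1) by blast
    then show ?thesis using star_of_size_Suc[OF less.prems 3 assms(2) b'(2,3)] by blast
  qed (use star_of_size_0 star_of_size_1 less.prems assms(3) in blast)+
qed

lemma star_decomposition:
  assumes "a \<in> A" "x a \<le> 1 / 3" "tie_bonus a E"
  obtains m w where "star_weight_bound m w" "weight (s a) = w * weight (t a)"
    "(real m + 1) * num_ext (t a) + E \<le> num_ext (s a)"
proof -
  obtain b where ab: "active_pair (s a) a b"
    using active_partner[OF active_start[OF assms(1)]] assms(2) by auto
  obtain m where "star_of_size a E (s a) b m"
    using exists_star_of_size[OF ab _ assms(3)] assms(2) by auto
  then have m: "(real m + 1) * num_ext (t a) + E \<le> num_ext (s a)"
    "weight (s a) = wt a * wt b ^ m * weight (t a)"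
    "t b + (real m - 1) * (1 / x b) \<le> t a" "t a < t b + real m * (1 / x b)"
    by (auto simp: star_of_size_def)
  define w v where "w = 1 / x a" and "v = 1 / x b"
  have xb: "x b = 1 - x a" using active_pair_sum[OF ab] by simp
  then have "0 < v" unfolding v_def using assms(2) by simp
  have wv: "w = (w - 1) * v"
    unfolding w_def v_def xb using x_pos[OF assms(1)] assms(2) by (simp add: field_simps)
  have b: "s b \<le> s a" "s a < t b" using ab by (auto simp: active_pair_def active_def)
  have "(real m - 1) * v < (w - 1) * v" using m(3) b(2) wv by (simp add: t_def w_def v_def)
  then have "real m < w" using \<open>0 < v\<close> by simp
  moreover have "(w - 1) * v < (real m + 1) * v"
    using m(4) b(1) wv by (simp add: t_def w_def v_def algebra_simps add_divide_distrib)
  then have "w - 2 < real m" using \<open>0 < v\<close> by simp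
  ultimately have "star_weight_bound m (wt a * wt b ^ m)"
    using wt_star[OF assms(1,2) xb] unfolding w_def by blast
  then show thesis using that m(1,2) by blast
qed

lemma exists_star_start_at_star_end:
  assumes "a \<in> A" "x a \<le> 1 / 3" "\<not> cut (t a)"
  shows "\<exists>a'. active (t a) a' \<and> s a' = t a \<and> x a' \<le> 1 / 3"
proof -
  obtain b where b: "b \<in> A" "s b < t a" "t a < t b" using assms(3) unfolding cut_def by blast
  then have "active_pair (max (s a) (s b)) b a"
    using active_overlap[OF active_start[OF assms(1)] b(1,2)] s_less_t[OF assms(1)]
    by (auto simp: active_pair_def)
  then obtain a' where "active_pair (t a) b a'" "s a' = t a" "x a' = x a"
    using next_partner b(3) by blast
  then show ?thesis using assms(2) by (auto simp: active_pair_def)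
qed

subsection \<open>Pairs of halves\<close>

definition half_pair :: "real \<Rightarrow> 'a \<Rightarrow> 'a \<Rightarrow> bool" where
  "half_pair \<sigma> a b \<longleftrightarrow> cut \<sigma> \<and> active_pair \<sigma> a b \<and> x a = 1 / 2"

text \<open>Such a pair lacks the extensions that make up for its weight \<open>\<beta>\<^sup>2 > 2\<close>. It has an
  incomparability to its left, and the factor \<open>\<beta>\<^sup>2 / 2\<close> is to be gained there.\<close>

definition right_isolated :: "real \<Rightarrow> bool" where
  "right_isolated \<sigma> \<longleftrightarrow> (\<exists>a b. half_pair \<sigma> a b \<and> \<not> on_isolated_edge a
    \<and> (\<forall>v. \<sigma> + 2 \<le> s v \<longrightarrow> \<not> a \<parallel> v \<and> \<not> b \<parallel> v))"

lemma half_pair_active: "half_pair \<sigma> a b \<Longrightarrow> active_pair \<sigma> a b"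
  by (simp add: half_pair_def)

lemma half_pair_commute: "half_pair \<sigma> a b \<Longrightarrow> half_pair \<sigma> b a"
  using active_pair_sum[of \<sigma> a b] by (auto simp: half_pair_def active_pair_commute)

lemma half_pair_bounds:
  assumes "half_pair \<sigma> a b"
  shows "s a = \<sigma>" "t a = \<sigma> + 2"
proof -
  show "s a = \<sigma>" using assms cut_active_start by (simp add: half_pair_def active_pair_def)
  moreover have half: "x a = 1 / 2" using assms unfolding half_pair_def by blast
  ultimately show "t a = \<sigma> + 2" unfolding t_def half by simp
qed

lemma half_pair_tie:
  assumes "half_pair \<sigma> a b"
  shows "t b = t a"
  using half_pair_bounds(2)[OF assms] half_pair_bounds(2)[OF half_pair_commute[OF assms]] by simp

lemma half_pair_cut: "half_pair \<sigma> a b \<Longrightarrow> cut (\<sigma> + 2)"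
  using tie_cut[OF half_pair_active half_pair_tie] half_pair_bounds(2) by fastforce

lemma half_pair_num_ext:
  assumes "half_pair \<sigma> a b"
  shows "2 * num_ext (\<sigma> + 2) \<le> num_ext \<sigma>"
  using num_ext_branch[OF half_pair_active[OF assms]] half_pair_tie[OF assms]
    half_pair_bounds(2)[OF assms] by simp

lemma half_pair_num_ext_without:
  assumes "half_pair \<sigma> a b" "active \<sigma> c"
  shows "num_ext (\<sigma> + 2) \<le> num_ext_without \<sigma> c"
proof -
  have "t c = \<sigma> + 2"
    using active_pair_exhausts[OF half_pair_active[OF assms(1)] assms(2)]
      half_pair_tie[OF assms(1)] half_pair_bounds(2)[OF assms(1)] by auto
  then show ?thesis using num_ext_end_le[OF assms(2)] by simp
qed

lemma half_pair_weight:
  assumes "half_pair \<sigma> a b"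
  shows "weight \<sigma> = (if on_isolated_edge a then 2 else \<beta>^2) * weight (\<sigma> + 2)"
proof -
  have half: "x a = 1 / 2" "x b = 1 / 2"
    using assms half_pair_commute[OF assms] by (simp_all add: half_pair_def)
  have "on_isolated_edge a \<longleftrightarrow> on_isolated_edge b"
    using isolated_edge_partner(1) half_pair_active[OF assms] active_pair_commute by blast
  then have "wt a * wt b = (if on_isolated_edge a then 2 else \<beta>^2)"
    using half by (simp add: wt_isolated_edge wt_middle power2_eq_square)
  then show ?thesis
    using weight_tie[OF half_pair_active[OF assms] half_pair_tie[OF assms]]
      half_pair_bounds(2)[OF assms] by simp
qed

lemma half_pair_meets:
  assumes "half_pair \<sigma> a b" "v \<in> A" "s v < \<sigma> + 2" "\<sigma> < t v"
  shows "v = a \<or> v = b"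
  using active_pair_overlap[OF half_pair_active[OF assms(1)] assms(2)] assms(3,4)
    half_pair_tie[OF assms(1)] half_pair_bounds(2)[OF assms(1)] by simp

lemma half_pair_ends:
  assumes "half_pair \<sigma> a b" "c \<in> A" "t c = \<sigma> + 2"
  shows "c = a \<or> c = b"
  using half_pair_meets[OF assms(1,2)] s_less_t[OF assms(2)] assms(3) by simp

lemma right_isolated_left_neighbour:
  assumes "right_isolated T"
  obtains c a where "c \<in> A" "t c = T" "c \<parallel> a" "active T a" "s a = T" "x a = 1 / 2"
proof -
  obtain a b where ab: "half_pair T a b" "\<not> on_isolated_edge a"
    "\<And>v. T + 2 \<le> s v \<Longrightarrow> \<not> a \<parallel> v \<and> \<not> b \<parallel> v"
    using assms unfolding right_isolated_def by blast
  have "a \<parallel> b" by (rule active_pair_incomparable[OF half_pair_active[OF ab(1)]])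
  then obtain p v where pv: "p = a \<or> p = b" "p \<parallel> v" "v \<noteq> a" "v \<noteq> b"
    using ab(2) incomparable_sym incomparable_mem unfolding on_isolated_edge_def by metis
  obtain q where p: "half_pair T p q" using pv(1) ab(1) half_pair_commute by blast
  have "t v \<le> T"
    using half_pair_meets[OF ab(1), of v] incomparable_mem[OF pv(2)] ab(3)[of v] pv by fastforce
  then obtain c where "c \<in> A" "t c = T" "c \<parallel> p"
    using left_crossing[OF _ incomparable_sym[OF pv(2)]] half_pair_bounds(1)[OF p] p
    unfolding half_pair_def by auto
  then show thesis
    using that[of c p] half_pair_bounds(1)[OF p] p by (simp add: half_pair_def active_pair_def)
qed

lemma not_right_isolated_of_no_crossing:
  assumes "\<And>c a. c \<in> A \<Longrightarrow> t c = T \<Longrightarrow> s a = T \<Longrightarrow> \<not> c \<parallel> a"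
  shows "\<not> right_isolated T"
  using assms by (metis right_isolated_left_neighbour)

lemma right_isolated_bounds:
  assumes "right_isolated T"
  shows "2 * num_ext (T + 2) \<le> num_ext T" "weight T = \<beta>^2 * weight (T + 2)"
    "\<And>c. active T c \<Longrightarrow> num_ext (T + 2) \<le> num_ext_without T c"
  using assms half_pair_num_ext half_pair_weight half_pair_num_ext_without
  unfolding right_isolated_def by auto

lemma right_isolated_tie_bonus:
  assumes "a \<in> A" "x a < 1 / 2" "right_isolated (t a)"
  shows "tie_bonus a (num_ext (t a + 2))"
proof -
  obtain c a' where c: "c \<in> A" "t c = t a" "c \<parallel> a'" "active (t a) a'" "x a' = 1 / 2"
    using right_isolated_left_neighbour[OF assms(3)] by metis
  have "c = a"
  proof (rule ccontr)
    assume "c \<noteq> a"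
    from active_pair_sum[OF same_end_active_pair[OF assms(1) c(1,2) this]]
    show False using incomparable_sum_le_1[OF c(3)] c(5) assms(2) by simp
  qed
  then have "2 * num_ext (t a) + num_ext_without (t a) a' \<le> num_ext \<tau>"
    if "active_pair \<tau> a b" "t b = t a" for \<tau> b
    using num_ext_crossing_branch[OF that c(4)] c(3) by simp
  moreover have "cut (t a)" using assms(3) unfolding right_isolated_def half_pair_def by blast
  ultimately show ?thesis
    using right_isolated_bounds(3)[OF assms(3) c(4)] unfolding tie_bonus_def by fastforce
qed

lemma half_pair_right_crossing:
  assumes "half_pair \<sigma> a b" "\<not> on_isolated_edge a" "\<not> right_isolated \<sigma>"
  obtains c where "active (\<sigma> + 2) c" "x c \<le> 1 / 2"
    "2 * num_ext (\<sigma> + 2) + num_ext_without (\<sigma> + 2) c \<le> num_ext \<sigma>"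
proof -
  obtain v where v: "\<sigma> + 2 \<le> s v" "a \<parallel> v \<or> b \<parallel> v"
    using assms unfolding right_isolated_def by blast
  then obtain p q where p: "half_pair \<sigma> p q" "p \<parallel> v" using assms(1) half_pair_commute by blast
  note t = half_pair_bounds(2)[OF p(1)]
  obtain c where c: "active (\<sigma> + 2) c" "p \<parallel> c"
    using right_crossing[OF half_pair_cut[OF p(1)] p(2) _ v(1)] t by auto
  have "x c \<le> 1 / 2" using incomparable_sum_le_1[OF c(2)] p(1) by (simp add: half_pair_def)
  moreover have "2 * num_ext (\<sigma> + 2) + num_ext_without (\<sigma> + 2) c \<le> num_ext \<sigma>"
    using num_ext_crossing_branch[OF half_pair_active[OF p(1)] half_pair_tie[OF p(1)]] c t by simp
  ultimately show thesis using that c(1) by blast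
qed

subsection \<open>Bounds at cuts and at starts of stars\<close>

text \<open>The inequality for \<open>c\<close> is what a pair of halves ending at \<open>\<sigma>\<close> needs if one of its elements is
  incomparable to \<open>c\<close>.\<close>

definition boundary_bound :: "real \<Rightarrow> bool" where
  "boundary_bound \<sigma> \<longleftrightarrow> (if right_isolated \<sigma> then weight (\<sigma> + 2) \<le> num_ext (\<sigma> + 2)
    else weight \<sigma> \<le> num_ext \<sigma> \<and> (\<forall>c. cut \<sigma> \<longrightarrow> active \<sigma> c \<longrightarrow> x c \<le> 1 / 2
      \<longrightarrow> \<beta>^2 * weight \<sigma> \<le> 2 * num_ext \<sigma> + num_ext_without \<sigma> c))"

lemma star_bound_right_isolated:
  assumes "a \<in> A" "x a \<le> 1 / 3" "right_isolated (t a)" "boundary_bound (t a)"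
  shows "weight (s a) \<le> num_ext (s a)" "\<beta>^2 * weight (s a) \<le> 2 * num_ext (s a) + num_ext (t a)"
proof -
  define X where "X = num_ext (t a + 2)"
  have "tie_bonus a X" unfolding X_def using assms by (intro right_isolated_tie_bonus) auto
  then obtain m w where m: "star_weight_bound m w" "weight (s a) = w * weight (t a)"
    "(real m + 1) * num_ext (t a) + X \<le> num_ext (s a)"
    using star_decomposition[OF assms(1,2)] by blast
  note T = right_isolated_bounds[OF assms(3), folded X_def]
  have X: "weight (t a + 2) \<le> X" "0 < weight (t a + 2)"
    using assms(3,4) weight_pos unfolding boundary_bound_def X_def by auto
  have "(real m + 1) * (2 * X) \<le> (real m + 1) * num_ext (t a)"
    using T(1) by (intro mult_left_mono) auto
  then have N: "(2 * real m + 3) * X \<le> num_ext (s a)" using m(3) by (simp add: algebra_simps)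
  have "weight (s a) = \<beta>^2 * w * weight (t a + 2)" using m(2) T(2) by simp
  also have "\<dots> \<le> (2 * real m + 3) * X"
    using m(1) X by (intro mult_mono) (auto simp: star_weight_bound_def)
  finally show "weight (s a) \<le> num_ext (s a)" using N by simp
  have "\<beta>^2 * weight (s a) = \<beta>^4 * w * weight (t a + 2)"
    using m(2) T(2) by (simp add: power4_eq_xxxx power2_eq_square)
  also have "\<dots> \<le> (4 * real m + 8) * X"
    using m(1) X by (intro mult_mono) (auto simp: star_weight_bound_def)
  also have "\<dots> \<le> 2 * num_ext (s a) + num_ext (t a)" using N T(1) by (simp add: algebra_simps)
  finally show "\<beta>^2 * weight (s a) \<le> 2 * num_ext (s a) + num_ext (t a)" .
qed

lemma star_bound_not_right_isolated:
  assumes "a \<in> A" "x a \<le> 1 / 3" "\<not> right_isolated (t a)" "boundary_bound (t a)"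
  shows "weight (s a) \<le> num_ext (s a)" "\<beta>^2 * weight (s a) \<le> 2 * num_ext (s a) + num_ext (t a)"
proof -
  obtain m w where m: "star_weight_bound m w" "weight (s a) = w * weight (t a)"
    "(real m + 1) * num_ext (t a) \<le> num_ext (s a)"
    using star_decomposition[OF assms(1,2) tie_bonus_0] by auto
  have T: "weight (t a) \<le> num_ext (t a)" "0 < weight (t a)"
    using assms(3,4) weight_pos unfolding boundary_bound_def by auto
  have "weight (s a) \<le> (real m + 1) * num_ext (t a)"
    unfolding m(2) using m(1) T by (intro mult_mono) (auto simp: star_weight_bound_def)
  then show "weight (s a) \<le> num_ext (s a)" using m(3) by simp
  have "\<beta>^2 * weight (s a) = \<beta>^2 * w * weight (t a)" using m(2) by simp
  also have "\<dots> \<le> (2 * real m + 3) * num_ext (t a)"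
    using m(1) T by (intro mult_mono) (auto simp: star_weight_bound_def)
  finally show "\<beta>^2 * weight (s a) \<le> 2 * num_ext (s a) + num_ext (t a)"
    using m(3) by (simp add: algebra_simps)
qed

lemma not_right_isolated_of_x_neq_half:
  assumes "active \<sigma> a" "x a \<noteq> 1 / 2"
  shows "\<not> right_isolated \<sigma>"
proof
  assume "right_isolated \<sigma>"
  then obtain p q where pq: "half_pair \<sigma> p q" unfolding right_isolated_def by blast
  then show False
    using active_pair_exhausts[OF half_pair_active[OF pq] assms(1)] half_pair_commute[OF pq]
      assms(2) by (auto simp: half_pair_def)
qed

lemma boundary_bound_star:
  assumes "active \<sigma> a" "s a = \<sigma>" "x a \<le> 1 / 3" "boundary_bound (t a)"
  shows "boundary_bound \<sigma>"
proof -
  have a: "a \<in> A" using assms(1) active_mem by blast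
  have star: "weight \<sigma> \<le> num_ext \<sigma>" "\<beta>^2 * weight \<sigma> \<le> 2 * num_ext \<sigma> + num_ext (t a)"
    using star_bound_right_isolated[OF a assms(3) _ assms(4)]
      star_bound_not_right_isolated[OF a assms(3) _ assms(4)] assms(2) by metis+
  have "c = a" if "active \<sigma> c" "x c \<le> 1 / 2" for c
  proof (rule ccontr)
    assume "c \<noteq> a"
    then have "x a + x c = 1"
      using assms(1) that(1) by (intro active_pair_sum) (auto simp: active_pair_def)
    then show False using assms(3) that(2) by simp
  qed
  moreover have "num_ext (t a) \<le> num_ext_without \<sigma> a" by (rule num_ext_end_le[OF assms(1)])
  moreover have "\<not> right_isolated \<sigma>"
    using assms(1,3) by (intro not_right_isolated_of_x_neq_half) auto
  ultimately show ?thesis unfolding boundary_bound_def using star by force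
qed

lemma boundary_bound_full:
  assumes "active \<sigma> u" "x u = 1" "boundary_bound (t u)"
  shows "boundary_bound \<sigma>"
proof -
  have u: "u \<in> A" using assms(1) active_mem by blast
  have full: "\<not> u \<parallel> v" for v using x_less_1[of u v] assms(2) by auto
  have "\<not> right_isolated (t u)"
  proof (rule not_right_isolated_of_no_crossing)
    fix c v assume c: "c \<in> A" "t c = t u"
    then have "c = u" using same_end_active_pair[OF u c] full active_pair_incomparable by blast
    then show "\<not> c \<parallel> v" using full by blast
  qed
  then have "weight (t u) \<le> num_ext (t u)" using assms(3) by (simp add: boundary_bound_def)
  moreover have "weight \<sigma> = weight (t u)" by (rule weight_full[OF assms(1,2)])
  moreover have "num_ext (t u) \<le> num_ext \<sigma>"
    using assms(1) by (intro num_ext_mono) (simp add: active_def)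
  moreover have "\<not> right_isolated \<sigma>"
    using assms(1,2) by (intro not_right_isolated_of_x_neq_half) auto
  moreover have "v = u" if "active \<sigma> v" for v
    using that assms(1) full active_pair_incomparable unfolding active_pair_def by blast
  ultimately show ?thesis unfolding boundary_bound_def using assms(2) by force
qed

lemma boundary_bound_isolated_edge:
  assumes "half_pair \<sigma> a b" "on_isolated_edge a" "boundary_bound (\<sigma> + 2)"
  shows "boundary_bound \<sigma>"
proof -
  note iso = isolated_edge_partner[OF half_pair_active[OF assms(1)] assms(2)]
  have "\<not> right_isolated (\<sigma> + 2)"
  proof (rule not_right_isolated_of_no_crossing)
    fix c v assume "c \<in> A" "t c = \<sigma> + 2" "s v = \<sigma> + 2"
    then have "c = a \<or> c = b" "v \<noteq> a" "v \<noteq> b"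
      using half_pair_ends[OF assms(1)] half_pair_bounds(1)[OF assms(1)]
        half_pair_bounds(1)[OF half_pair_commute[OF assms(1)]] by auto
    then show "\<not> c \<parallel> v" using iso(2,3) by blast
  qed
  then have T: "weight (\<sigma> + 2) \<le> num_ext (\<sigma> + 2)" using assms(3) by (simp add: boundary_bound_def)
  have weight: "weight \<sigma> = 2 * weight (\<sigma> + 2)" using half_pair_weight[OF assms(1)] assms(2) by simp
  note num_ext = half_pair_num_ext[OF assms(1)]
  have "\<beta>^2 * weight \<sigma> \<le> 2 * num_ext \<sigma> + num_ext_without \<sigma> c" if "active \<sigma> c" for c
  proof -
    have "\<beta>^2 * weight \<sigma> \<le> (223 / 100) * (2 * num_ext (\<sigma> + 2))"
      unfolding weight using \<beta>_power_bounds(1) T weight_pos[of "\<sigma> + 2"] by (intro mult_mono) auto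
    then show ?thesis
      using half_pair_num_ext_without[OF assms(1) that] num_ext num_ext_nonneg[of "\<sigma> + 2"]
      by linarith
  qed
  moreover have "\<not> right_isolated \<sigma>"
  proof
    assume "right_isolated \<sigma>"
    then obtain p q where pq: "half_pair \<sigma> p q" "\<not> on_isolated_edge p"
      unfolding right_isolated_def by blast
    then have "p = a \<or> p = b"
      using active_pair_exhausts[OF half_pair_active[OF assms(1)]] half_pair_active
      unfolding active_pair_def by blast
    then show False using pq(2) assms(2) iso(1) by blast
  qed
  ultimately show ?thesis unfolding boundary_bound_def using T weight num_ext by auto
qed

lemma boundary_bound_right_isolated:
  assumes "right_isolated \<sigma>" "boundary_bound (\<sigma> + 2)"
  shows "boundary_bound \<sigma>"
proof -
  obtain a b where ab: "half_pair \<sigma> a b" "\<And>v. \<sigma> + 2 \<le> s v \<Longrightarrow> \<not> a \<parallel> v \<and> \<not> b \<parallel> v"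
    using assms(1) unfolding right_isolated_def by blast
  have "\<not> right_isolated (\<sigma> + 2)"
    using half_pair_ends[OF ab(1)] ab(2) by (intro not_right_isolated_of_no_crossing) fastforce
  then show ?thesis using assms unfolding boundary_bound_def by simp
qed

lemma half_pair_crossing_bound:
  assumes "half_pair \<sigma> a b" "\<not> on_isolated_edge a" "\<not> right_isolated \<sigma>" "boundary_bound (\<sigma> + 2)"
  shows "weight \<sigma> \<le> num_ext \<sigma>" "\<beta>^2 * weight \<sigma> \<le> 2 * num_ext \<sigma> + num_ext (\<sigma> + 2)"
proof -
  define T where "T = \<sigma> + 2"
  obtain c where c: "active T c" "x c \<le> 1 / 2" "2 * num_ext T + num_ext_without T c \<le> num_ext \<sigma>"
    unfolding T_def by (rule half_pair_right_crossing[OF assms(1-3)])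
  have weight: "weight \<sigma> = \<beta>^2 * weight T"
    using half_pair_weight[OF assms(1)] assms(2) by (simp add: T_def)
  have "weight \<sigma> \<le> num_ext \<sigma> \<and> \<beta>^2 * weight \<sigma> \<le> 2 * num_ext \<sigma> + num_ext T"
  proof (cases "right_isolated T")
    case True
    define X where "X = num_ext (T + 2)"
    note isolated = right_isolated_bounds[OF True, folded X_def]
    have X: "weight (T + 2) \<le> X" "0 < weight (T + 2)"
      using assms(4) True weight_pos unfolding boundary_bound_def X_def T_def by auto
    have "weight \<sigma> = \<beta>^4 * weight (T + 2)" "\<beta>^2 * weight \<sigma> = \<beta>^6 * weight (T + 2)"
      unfolding weight isolated(2) by (simp_all flip: power_add mult.assoc)
    moreover have "\<beta>^4 * weight (T + 2) \<le> 5 * X" "\<beta>^6 * weight (T + 2) \<le> 11 * X"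
      using \<beta>_power_bounds X by (intro mult_mono; simp)+
    ultimately show ?thesis using c(3) isolated(1) isolated(3)[OF c(1)] X by linarith
  next
    case False
    then have T: "weight T \<le> num_ext T" "\<beta>^2 * weight T \<le> 2 * num_ext T + num_ext_without T c"
      using assms(4) half_pair_cut[OF assms(1)] c(1,2) unfolding boundary_bound_def T_def by auto
    have "\<beta>^2 * weight \<sigma> = \<beta>^4 * weight T" unfolding weight by (simp flip: power_add mult.assoc)
    also have "\<dots> \<le> 5 * num_ext T"
      using \<beta>_power_bounds(3) T(1) weight_pos[of T] by (intro mult_mono) auto
    also have "\<dots> \<le> 2 * num_ext \<sigma> + num_ext T"
      using half_pair_num_ext[OF assms(1)] unfolding T_def by simp
    finally show ?thesis using weight T(2) c(3) by simp
  qed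
  then show "weight \<sigma> \<le> num_ext \<sigma>" "\<beta>^2 * weight \<sigma> \<le> 2 * num_ext \<sigma> + num_ext (\<sigma> + 2)"
    unfolding T_def by blast+
qed

lemma boundary_bound_half_pair:
  assumes "half_pair \<sigma> a b" "boundary_bound (\<sigma> + 2)"
  shows "boundary_bound \<sigma>"
proof -
  consider "on_isolated_edge a" | "right_isolated \<sigma>" | "\<not> on_isolated_edge a" "\<not> right_isolated \<sigma>"
    by blast
  then show ?thesis
  proof cases
    case 3
    then show ?thesis
      using half_pair_crossing_bound[OF assms(1) 3 assms(2)] half_pair_num_ext_without[OF assms(1)]
      unfolding boundary_bound_def by force
  qed (use assms boundary_bound_isolated_edge boundary_bound_right_isolated in blast)+
qed

subsection \<open>Elements with \<open>1 / 3 < x < 1 / 2\<close>\<close>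

definition middle_pair :: "real \<Rightarrow> 'a \<Rightarrow> 'a \<Rightarrow> bool" where
  "middle_pair \<tau> a b \<longleftrightarrow> active_pair \<tau> a b \<and> 1 / 3 < x a \<and> x a < 1 / 2"

text \<open>Let \<open>Y\<close> and \<open>Z\<close> be the numbers of extensions at the start of an element with
  \<open>1 / 3 < x < 1 / 2\<close> and at the next end. At the preceding such start, they are \<open>(2 Y + Z, Y + Z)\<close>
  or \<open>(3 Y + Z, 2 Y + Z)\<close>, with two or three more elements; at a cut with two more elements, the
  right-hand sides in \<open>boundary_bound\<close> are \<open>2 Y + Z\<close> and \<open>5 Y + 2 Z\<close>.\<close>

definition crossing_bound :: "real \<Rightarrow> real \<Rightarrow> real \<Rightarrow> bool" where
  "crossing_bound Y Z B \<longleftrightarrow> \<beta>^2 * B \<le> 2 * Y + Z \<and> \<beta>^3 * B \<le> 3 * Y + Z \<and> \<beta>^4 * B \<le> 5 * Y + 2 * Z"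

lemma crossing_bound_mono: "crossing_bound Y Z B \<Longrightarrow> Y \<le> Y' \<Longrightarrow> Z \<le> Z' \<Longrightarrow> crossing_bound Y' Z' B"
  unfolding crossing_bound_def by linarith

lemma crossing_bound_two:
  assumes "crossing_bound Y Z B" "0 \<le> Y" "0 \<le> Z" "0 \<le> B"
  shows "crossing_bound (2 * Y + Z) (Y + Z) (\<beta>^2 * B)"
proof -
  have B: "\<beta>^2 * B \<le> 2 * Y + Z" "\<beta>^4 * B \<le> 5 * Y + 2 * Z" "0 \<le> \<beta>^2 * B"
    using assms(1,4) unfolding crossing_bound_def by auto
  have "\<beta>^3 * (\<beta>^2 * B) \<le> (10 / 3) * (2 * Y + Z)"
    by (rule mult_mono[OF \<beta>_power_bounds(2) B(1) _ B(3)]) simp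
  moreover have "\<beta>^4 * (\<beta>^2 * B) \<le> 5 * (2 * Y + Z)"
    by (rule mult_mono[OF \<beta>_power_bounds(3) B(1) _ B(3)]) simp
  moreover have "\<beta>^2 * (\<beta>^2 * B) = \<beta>^4 * B" by (simp flip: power_add mult.assoc)
  ultimately show ?thesis using B(2) assms(2,3) unfolding crossing_bound_def by argo
qed

lemma crossing_bound_three:
  assumes "crossing_bound Y Z B" "0 \<le> Y" "0 \<le> Z" "0 \<le> B"
  shows "crossing_bound (3 * Y + Z) (2 * Y + Z) (\<beta>^3 * B)"
proof -
  have B: "\<beta>^3 * B \<le> 3 * Y + Z" "0 \<le> \<beta>^3 * B"
    using assms(1,4) \<beta>_ge_1 unfolding crossing_bound_def by auto
  have "\<beta>^2 * (\<beta>^3 * B) \<le> (223 / 100) * (3 * Y + Z)"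
    by (rule mult_mono[OF \<beta>_power_bounds(1) B(1) _ B(2)]) simp
  moreover have "\<beta>^3 * (\<beta>^3 * B) \<le> (10 / 3) * (3 * Y + Z)"
    by (rule mult_mono[OF \<beta>_power_bounds(2) B(1) _ B(2)]) simp
  moreover have "\<beta>^4 * (\<beta>^3 * B) \<le> 5 * (3 * Y + Z)"
    by (rule mult_mono[OF \<beta>_power_bounds(3) B(1) _ B(2)]) simp
  ultimately show ?thesis using assms(2,3) unfolding crossing_bound_def by argo
qed

lemma crossing_bound_tie:
  assumes "0 < B" "B \<le> X"
  shows "crossing_bound (3 * X) (2 * X) (\<beta>^3 * B)"
proof -
  have "\<beta>^5 * B \<le> 8 * X" "\<beta>^6 * B \<le> 11 * X" "\<beta>^7 * B \<le> 19 * X"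
    using assms \<beta>_power_bounds by (intro mult_mono; simp)+
  then show ?thesis
    using assms unfolding crossing_bound_def by (auto simp flip: power_add mult.assoc)
qed

lemma crossing_bound_tie_right_isolated:
  assumes "0 < B" "B \<le> X"
  shows "crossing_bound (7 * X) (5 * X) (\<beta>^5 * B)"
proof -
  have "\<beta>^7 * B \<le> 19 * X" "\<beta>^8 * B \<le> 26 * X" "\<beta>^9 * B \<le> 45 * X"
    using assms \<beta>_power_bounds by (intro mult_mono; simp)+
  then show ?thesis
    using assms unfolding crossing_bound_def by (auto simp flip: power_add mult.assoc)
qed

lemma middle_pair_active: "middle_pair \<tau> a b \<Longrightarrow> active_pair \<tau> a b"
  by (simp add: middle_pair_def)

lemma middle_pair_wt:
  assumes "middle_pair \<tau> a b"
  shows "wt a = \<beta>" "wt b = \<beta>"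
  using assms isolated_edge_half[of a] isolated_edge_half[of b] active_pair_sum[of \<tau> a b]
  by (auto simp: middle_pair_def intro!: wt_middle)

lemma middle_pair_length:
  assumes "middle_pair \<tau> a b"
  shows "1 / x b < 1 / x a" "1 / x a < 2 / x b"
proof -
  have "x b = 1 - x a" "1 / 3 < x a" "x a < 1 / 2"
    using assms active_pair_sum[of \<tau> a b] by (auto simp: middle_pair_def)
  then show "1 / x b < 1 / x a" "1 / x a < 2 / x b" by (simp_all add: field_simps)
qed

lemma middle_pair_next:
  assumes "middle_pair \<tau> a b" "t b < t a"
  obtains b' where "middle_pair (t b) a b'" "s b' = t b" "x b' = x b"
  using next_partner[OF middle_pair_active[OF assms(1)] assms(2)] assms(1)
  unfolding middle_pair_def by blast

lemma middle_pair_weight: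
  assumes "middle_pair \<tau> a b"
  shows "t b < t a \<Longrightarrow> weight \<tau> = \<beta> * weight (t b)" "t a < t b \<Longrightarrow> weight \<tau> = \<beta> * weight (t a)"
    "t b = t a \<Longrightarrow> weight \<tau> = \<beta>^2 * weight (t a)"
proof -
  note ab = middle_pair_active[OF assms]
  show "t b < t a \<Longrightarrow> weight \<tau> = \<beta> * weight (t b)" "t a < t b \<Longrightarrow> weight \<tau> = \<beta> * weight (t a)"
    "t b = t a \<Longrightarrow> weight \<tau> = \<beta>^2 * weight (t a)"
    using weight_first_end[OF ab] weight_first_end[OF active_pair_commute[OF ab]] weight_tie[OF ab]
      middle_pair_wt[OF assms] by (simp_all add: power2_eq_square)
qed

definition middle_bound :: "real \<Rightarrow> bool" where
  "middle_bound \<sigma> \<longleftrightarrow> (\<forall>a b. middle_pair \<sigma> a b \<longrightarrow> s a = \<sigma> \<longrightarrow> s b < \<sigma>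
    \<longrightarrow> crossing_bound (num_ext \<sigma>) (num_ext (t b)) (weight \<sigma>))"

lemma middle_pair_last:
  assumes "middle_pair \<tau> a b" "t a < t b" "middle_bound (t a)"
  shows "crossing_bound (num_ext (t a)) (num_ext (t b)) (weight (t a))"
proof -
  note ab = middle_pair_active[OF assms(1)]
  obtain a' where a': "active_pair (t a) b a'" "s a' = t a" "x a' = x a"
    using next_partner[OF active_pair_commute[OF ab] assms(2)] by blast
  have "middle_pair (t a) a' b"
    using a' assms(1) active_pair_commute by (auto simp: middle_pair_def)
  moreover have "s b < t a" using ab by (auto simp: active_pair_def active_def)
  ultimately show ?thesis using assms(3) a'(2) unfolding middle_bound_def by blast
qed

lemma middle_pair_tie:
  assumes "middle_pair \<tau> a b" "t b = t a" "boundary_bound (t a)"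
  shows "crossing_bound (num_ext (t a) + num_ext \<tau>) (num_ext \<tau>) (\<beta> * weight \<tau>)"
proof -
  define T where "T = t a"
  note ab = middle_pair_active[OF assms(1)]
  have weight: "\<beta> * weight \<tau> = \<beta>^3 * weight T"
    using middle_pair_weight(3)[OF assms(1,2)] by (simp add: T_def power3_eq_cube power2_eq_square)
  show ?thesis
  proof (cases "right_isolated T")
    case True
    define X where "X = num_ext (T + 2)"
    have "a \<in> A" "x a < 1 / 2" using active_pair_mem[OF ab] assms(1) by (auto simp: middle_pair_def)
    then have "2 * num_ext T + X \<le> num_ext \<tau>"
      using right_isolated_tie_bonus True ab assms(2) unfolding tie_bonus_def T_def X_def by blast
    then have "5 * X \<le> num_ext \<tau>" "7 * X \<le> num_ext T + num_ext \<tau>"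
      using right_isolated_bounds(1)[OF True] unfolding X_def by linarith+
    moreover have "crossing_bound (7 * X) (5 * X) (\<beta>^5 * weight (T + 2))"
      using assms(3) True weight_pos unfolding boundary_bound_def T_def X_def
      by (intro crossing_bound_tie_right_isolated) auto
    moreover have "\<beta> * weight \<tau> = \<beta>^5 * weight (T + 2)"
      unfolding weight right_isolated_bounds(2)[OF True] by (simp flip: power_add mult.assoc)
    ultimately show ?thesis using crossing_bound_mono unfolding T_def by metis
  next
    case False
    have "2 * num_ext T \<le> num_ext \<tau>" using num_ext_branch[OF ab] assms(2) unfolding T_def by simp
    moreover from this have "3 * num_ext T \<le> num_ext T + num_ext \<tau>" by linarith
    moreover have "crossing_bound (3 * num_ext T) (2 * num_ext T) (\<beta> * weight \<tau>)"
      unfolding weight using assms(3) False weight_pos unfolding boundary_bound_def T_def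
      by (intro crossing_bound_tie) auto
    ultimately show ?thesis using crossing_bound_mono unfolding T_def by metis
  qed
qed

lemma middle_pair_step:
  assumes "middle_pair \<tau> a b" "s b = \<tau>" "t a < \<tau> + 2 / x b"
    and boundary: "cut (t a) \<Longrightarrow> boundary_bound (t a)" and middle: "middle_bound (t a)"
  shows "crossing_bound (num_ext (t a) + num_ext \<tau>) (num_ext \<tau>) (\<beta> * weight \<tau>)"
proof -
  note ab = middle_pair_active[OF assms(1)]
  note branch = num_ext_branch[OF ab]
  consider "t b = t a" | "t a < t b" | "t b < t a" by linarith
  then show ?thesis
  proof cases
    case 1
    then show ?thesis using middle_pair_tie[OF assms(1)] boundary tie_cut[OF ab] by blast
  next
    case 2
    have "crossing_bound (2 * num_ext (t a) + num_ext (t b)) (num_ext (t a) + num_ext (t b))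
        (\<beta>^2 * weight (t a))"
      using middle_pair_last[OF assms(1) 2 middle] weight_pos
      by (intro crossing_bound_two num_ext_nonneg) (auto intro: less_imp_le)
    moreover have "\<beta> * weight \<tau> = \<beta>^2 * weight (t a)"
      using middle_pair_weight(2)[OF assms(1) 2] by (simp add: power2_eq_square)
    ultimately show ?thesis using crossing_bound_mono branch by auto
  next
    case 3
    obtain b' where b': "middle_pair (t b) a b'" "s b' = t b" "x b' = x b"
      using middle_pair_next[OF assms(1) 3] .
    have last: "t a < t b'" using b'(2,3) assms(2,3) by (simp add: t_def)
    have "crossing_bound (3 * num_ext (t a) + num_ext (t b')) (2 * num_ext (t a) + num_ext (t b'))
        (\<beta>^3 * weight (t a))"
      using middle_pair_last[OF b'(1) last middle] weight_pos
      by (intro crossing_bound_three num_ext_nonneg) (auto intro: less_imp_le)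
    moreover have "\<beta> * weight \<tau> = \<beta>^3 * weight (t a)"
      using middle_pair_weight(1)[OF assms(1) 3] middle_pair_weight(2)[OF b'(1) last]
      by (simp add: power3_eq_cube)
    moreover have "2 * num_ext (t a) + num_ext (t b') \<le> num_ext \<tau>"
      using branch num_ext_branch[OF middle_pair_active[OF b'(1)]] by simp
    ultimately show ?thesis by (simp add: crossing_bound_mono)
  qed
qed

lemma middle_bound_step:
  assumes "\<And>v. v \<in> rest \<sigma> \<Longrightarrow> (cut (t v) \<longrightarrow> boundary_bound (t v)) \<and> middle_bound (t v)"
  shows "middle_bound \<sigma>"
  unfolding middle_bound_def
proof (intro allI impI)
  fix a b assume ab: "middle_pair \<sigma> a b" "s a = \<sigma>" "s b < \<sigma>"
  have first: "t b < t a" using middle_pair_length(1)[OF ab(1)] ab(2,3) by (simp add: t_def)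
  obtain b' where b': "middle_pair (t b) a b'" "s b' = t b" "x b' = x b"
    using middle_pair_next[OF ab(1) first] .
  have "active \<sigma> a" "\<sigma> < t b"
    using middle_pair_active[OF ab(1)] by (auto simp: active_pair_def active_def)
  then have "a \<in> rest \<sigma>" "t a < t b + 2 / x b'"
    using active_in_rest middle_pair_length(2)[OF ab(1)] ab(2) b'(3) by (auto simp: t_def)
  then have "crossing_bound (num_ext (t a) + num_ext (t b)) (num_ext (t b)) (\<beta> * weight (t b))"
    using middle_pair_step[OF b'(1,2)] assms by blast
  then show "crossing_bound (num_ext \<sigma>) (num_ext (t b)) (weight \<sigma>)"
    using crossing_bound_mono[OF _ num_ext_branch[OF middle_pair_active[OF ab(1)]]]
      middle_pair_weight(1)[OF ab(1) first] by simp
qed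

lemma boundary_bound_middle:
  assumes "cut \<sigma>" and ab: "middle_pair \<sigma> a b" and middle: "middle_bound (t a)"
  shows "boundary_bound \<sigma>"
proof -
  note pair = middle_pair_active[OF ab]
  have s: "s a = \<sigma>" "s b = \<sigma>"
    using cut_active_start[OF assms(1)] pair by (auto simp: active_pair_def)
  then have first: "t b < t a" using middle_pair_length(1)[OF ab] by (simp add: t_def)
  obtain b' where b': "middle_pair (t b) a b'" "s b' = t b" "x b' = x b"
    using middle_pair_next[OF ab first] .
  have last: "t a < t b'" using middle_pair_length(2)[OF ab] s b'(2,3) by (simp add: t_def)
  have num_ext: "2 * num_ext (t a) + num_ext (t b') \<le> num_ext \<sigma>"
    using num_ext_branch[OF pair] num_ext_branch[OF middle_pair_active[OF b'(1)]] by simp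
  have weight: "weight \<sigma> = \<beta>^2 * weight (t a)"
    using middle_pair_weight(1)[OF ab first] middle_pair_weight(2)[OF b'(1) last]
    by (simp add: power2_eq_square)
  have "\<beta>^2 * weight \<sigma> = \<beta>^4 * weight (t a)" unfolding weight by (simp flip: power_add mult.assoc)
  then have bound: "weight \<sigma> \<le> num_ext \<sigma>" "\<beta>^2 * weight \<sigma> \<le> 2 * num_ext \<sigma> + num_ext (t a)"
    using middle_pair_last[OF b'(1) last middle] num_ext
      num_ext_nonneg[of "t a"] num_ext_nonneg[of "t b'"]
    unfolding crossing_bound_def weight by linarith+
  have a: "active \<sigma> a" "x a < 1 / 2" using ab by (auto simp: middle_pair_def active_pair_def)
  have "c = a" if "active \<sigma> c" "x c \<le> 1 / 2" for c
    using active_pair_exhausts[OF pair that(1)] active_pair_sum[OF pair] a(2) that(2) by auto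
  moreover have "num_ext (t a) \<le> num_ext_without \<sigma> a" by (rule num_ext_end_le[OF a(1)])
  moreover have "\<not> right_isolated \<sigma>" using a by (intro not_right_isolated_of_x_neq_half) auto
  ultimately show ?thesis unfolding boundary_bound_def using bound by force
qed

subsection \<open>The induction\<close>

definition boundary :: "real \<Rightarrow> bool" where
  "boundary \<sigma> \<longleftrightarrow> 0 \<le> \<sigma> \<and> \<sigma> \<le> L \<and> (cut \<sigma> \<or> (\<exists>a. active \<sigma> a \<and> s a = \<sigma> \<and> x a \<le> 1 / 3))"

lemma boundary_end:
  assumes "v \<in> A" "cut (t v) \<or> x v \<le> 1 / 3"
  shows "boundary (t v)"
  using assms s_nonneg[of v] s_less_t[of v] t_le_L[of v] exists_star_start_at_star_end[OF assms(1)]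
  by (auto simp: boundary_def)

lemma boundary_bound_L:
  assumes "rest \<sigma> = {}"
  shows "boundary_bound \<sigma>"
proof -
  have "\<not> active \<sigma> v" for v using assms active_in_rest by blast
  then have "\<not> right_isolated \<sigma>" by (auto simp: right_isolated_def half_pair_def active_pair_def)
  then show ?thesis
    using assms \<open>\<And>v. \<not> active \<sigma> v\<close>
    by (simp add: boundary_bound_def num_ext_def weight_def num_linear_extensions_empty)
qed

lemma boundary_bound_cut:
  assumes IH: "\<And>v. v \<in> rest \<sigma> \<Longrightarrow> (boundary (t v) \<longrightarrow> boundary_bound (t v)) \<and> middle_bound (t v)"
    and \<sigma>: "cut \<sigma>" "0 \<le> \<sigma>" "\<sigma> < L"
  shows "boundary_bound \<sigma>"
  using \<sigma>(2,3)
proof (cases rule: active_cases)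
  case (single u)
  have "boundary (t u)"
    using active_mem[OF single(1)] full_cut[OF single(1,2)] by (intro boundary_end) auto
  then show ?thesis
    using IH[OF active_in_rest[OF single(1)]] boundary_bound_full[OF single(1,2)] by blast
next
  case (pair u v)
  then have "x u + x v = 1" by (rule active_pair_sum)
  then have "x u \<le> 1 / 2 \<or> x v \<le> 1 / 2" by linarith
  then obtain a b where ab: "active_pair \<sigma> a b" "x a \<le> 1 / 2"
    using pair active_pair_commute by blast
  have a: "a \<in> A" "active \<sigma> a" "a \<in> rest \<sigma>"
    using active_pair_mem[OF ab(1)] ab(1) active_in_rest by (auto simp: active_pair_def)
  consider "x a \<le> 1 / 3" | "middle_pair \<sigma> a b" | "half_pair \<sigma> a b"
    using ab \<sigma>(1) unfolding middle_pair_def half_pair_def by fastforce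
  then show ?thesis
  proof cases
    case 1
    then show ?thesis
      using boundary_bound_star[OF a(2)] cut_active_start[OF \<sigma>(1) a(2)] IH[OF a(3)]
        boundary_end[OF a(1)]
      by blast
  next
    case 2
    then show ?thesis using boundary_bound_middle[OF \<sigma>(1)] IH[OF a(3)] by blast
  next
    case 3
    then show ?thesis
      using boundary_bound_half_pair IH[OF a(3)] boundary_end[OF a(1)] half_pair_cut
      unfolding half_pair_bounds(2)[OF 3] by blast
  qed
qed

lemma boundary_and_middle_bound: "(boundary \<sigma> \<longrightarrow> boundary_bound \<sigma>) \<and> middle_bound \<sigma>"
proof (induction \<sigma> rule: rest_induct)
  case (less \<sigma>)
  have "boundary_bound \<sigma>" if \<sigma>: "boundary \<sigma>"
  proof -
    consider a where "active \<sigma> a" "s a = \<sigma>" "x a \<le> 1 / 3" | "cut \<sigma>" "0 \<le> \<sigma>" "\<sigma> < L" | "\<sigma> = L"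
      using \<sigma> unfolding boundary_def by fastforce
    then show ?thesis
    proof cases
      case (1 a)
      then show ?thesis
        using boundary_bound_star less.IH[OF active_in_rest] boundary_end active_mem by blast
    next
      case 2
      then show ?thesis using boundary_bound_cut less.IH by blast
    next
      case 3
      then have "rest \<sigma> = {}" using t_le_L by (force simp: rest_def)
      then show ?thesis by (rule boundary_bound_L)
    qed
  qed
  moreover have "middle_bound \<sigma>"
    using less.IH boundary_end rest_subset by (intro middle_bound_step) blast
  ultimately show ?case by blast
qed

theorem prod_wt_le_num_linear_extensions: "prod wt A \<le> real (num_linear_extensions r A)"
proof (cases "A = {}")
  case True
  then show ?thesis by (simp add: num_linear_extensions_empty)
next
  case False
  have t_pos: "0 < t v" if "v \<in> A" for v using s_nonneg[OF that] s_less_t[OF that] by simp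
  then have rest_0: "rest 0 = A" by (auto simp: rest_def)
  have "boundary 0" using False t_pos t_le_L s_nonneg by (force simp: boundary_def cut_def)
  moreover have "\<not> right_isolated 0"
    using t_pos by (metis less_irrefl right_isolated_left_neighbour)
  ultimately show ?thesis
    using boundary_and_middle_bound[of 0]
    by (simp add: boundary_bound_def weight_def num_ext_def rest_0)
qed

end


section \<open>The entropy bound\<close>

context interval_layout
begin

lemma rounded_in_STAB:
  "(\<lambda>v. if v \<in> A then round_unit (x v) else 0) \<in> STAB A (incomparability A r)"
proof -
  obtain f where "chain_colouring r A 2 f"
    using dilworth[OF partial_order finite_A subset_refl antichain_card_le_2] by blast
  then have f: "f v < 2" "\<And>u. u \<in> A \<Longrightarrow> f u = f v \<Longrightarrow> (u, v) \<in> r \<or> (v, u) \<in> r" if "v \<in> A" for v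
    using that unfolding chain_colouring_def by blast+
  have chain: "chain {v \<in> A. f v = i}" for i unfolding chain_iff using f(2) by fastforce
  have partition: "A = {v \<in> A. f v = 0} \<union> {v \<in> A. f v = 1}"
    using f(1) by (auto simp: less_2_cases_iff)
  have edge: "round_unit (x u) + round_unit (x v) \<le> 1" if "u \<parallel> v" for u v
    using that incomparable_mem[OF that] x_pos
    by (intro round_unit_sum_le_1 incomparable_sum_le_1) (auto intro: less_imp_le)
  have "round_unit (x v) \<le> 1" if "v \<in> A" for v
    using x_pos[OF that] x_le_1[OF that] by (intro round_unit_le_1) auto
  then show ?thesis
    using round_unit_x_pos edge incomparable_mem
    by (intro bipartite_fractional_in_STAB[OF finite_A chain chain partition])
      (auto intro: less_imp_le)
qed

lemma entropy_le_sum_log_round_unit: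
  "real (card A) * incomparability_entropy A r \<le> (\<Sum>v\<in>A. - log 2 (round_unit (x v)))"
proof -
  have "real (card A) * incomparability_entropy A r
      \<le> (\<Sum>v\<in>A. - log 2 (if v \<in> A then round_unit (x v) else 0))"
    unfolding incomparability_entropy_def using round_unit_x_pos
    by (intro card_mult_graph_entropy_le rounded_in_STAB
        finite_simple_graph_incomparability finite_A) simp
  then show ?thesis by (simp cong: sum.cong)
qed

lemma isolated_edge_component:
  assumes "v \<parallel> u" "\<And>w. v \<parallel> w \<Longrightarrow> w = u" "\<And>w. u \<parallel> w \<Longrightarrow> w = v"
  shows "{v, u} \<in> connected_components A (incomparability A r)"
proof -
  define R where "R = {(p, q). p \<in> A \<and> q \<in> A \<and> (p, q) \<in> (incomparability A r)\<^sup>*}"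
  have mem: "v \<in> A" "u \<in> A" using incomparable_mem[OF assms(1)] by auto
  have "w = v \<or> w = u" if "(v, w) \<in> (incomparability A r)\<^sup>*" for w
    using that by induction (use assms(2,3) in blast)+
  then have "R `` {v} = {v, u}" using mem assms(1) unfolding R_def by auto
  then show ?thesis
    using quotientI[OF mem(1), of R] unfolding connected_components_def R_def by simp
qed

lemma card_isolated_edges_le: "card {v \<in> A. on_isolated_edge v} \<le> 2 * kappa2 A r"
proof -
  define \<C> where "\<C> = {C \<in> connected_components A (incomparability A r). card C = 2}"
  have "{v \<in> A. on_isolated_edge v} \<subseteq> \<Union> \<C>"
  proof
    fix v assume "v \<in> {v \<in> A. on_isolated_edge v}"
    then obtain u where u: "v \<parallel> u" "\<And>w. v \<parallel> w \<Longrightarrow> w = u" "\<And>w. u \<parallel> w \<Longrightarrow> w = v"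
      unfolding on_isolated_edge_def by blast
    have "{v, u} \<in> \<C>"
      using isolated_edge_component[OF u] incomparable_mem[OF u(1)] by (simp add: \<C>_def)
    then show "v \<in> \<Union> \<C>" by blast
  qed
  moreover have "finite (\<Union> \<C>)"
    unfolding \<C>_def using finite_connected_components[OF finite_A]
    by (intro finite_Union) (auto intro: card_ge_0_finite)
  ultimately have "card {v \<in> A. on_isolated_edge v} \<le> card (\<Union> \<C>)" by (rule card_mono[rotated])
  also have "\<dots> \<le> sum card \<C>" by (rule card_Union_le_sum_card)
  also have "\<dots> = 2 * kappa2 A r" by (simp add: \<C>_def kappa2_def)
  finally show ?thesis .
qed

lemma \<gamma>_mult_log_wt:
  assumes "v \<in> A"
  shows "\<gamma> * log 2 (wt v)
    = - log 2 (round_unit (x v)) - (if on_isolated_edge v then 1 - \<gamma> / 2 else 0)"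
proof (cases "on_isolated_edge v")
  case True
  have half: "round_unit (x v) = 1 / 2"
    using isolated_edge_half[OF True] by (simp add: round_unit_middle)
  have log: "log 2 (wt v) = 1 / 2" using wt_isolated_edge[OF True] by (simp add: log_def ln_sqrt)
  show ?thesis unfolding half log using True by (simp add: log_divide)
next
  case False
  then show ?thesis
    using round_unit_x_pos[OF assms] \<gamma>_bounds(1) by (simp add: wt_def log_powr log_divide)
qed

lemma sum_log_round_unit_le:
  "(\<Sum>v\<in>A. - log 2 (round_unit (x v)))
    \<le> \<gamma> * log 2 (real (num_linear_extensions r A)) + (2 - \<gamma>) * real (kappa2 A r)"
proof -
  define I where "I = {v \<in> A. on_isolated_edge v}"
  have "(\<Sum>v\<in>A. - log 2 (round_unit (x v)))
      = (\<Sum>v\<in>A. \<gamma> * log 2 (wt v) + (if on_isolated_edge v then 1 - \<gamma> / 2 else 0))"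
    using \<gamma>_mult_log_wt by (intro sum.cong) auto
  also have "\<dots> = \<gamma> * (\<Sum>v\<in>A. log 2 (wt v)) + (1 - \<gamma> / 2) * real (card I)"
    using finite_A by (simp add: sum.distrib sum_distrib_left sum.If_cases I_def Int_def)
  also have "(\<Sum>v\<in>A. log 2 (wt v)) = log 2 (prod wt A)"
    using finite_A less_imp_neq[OF wt_pos]
    by (subst log_def, subst ln_prod) (auto simp: log_def sum_divide_distrib)
  also have "\<gamma> * log 2 (prod wt A) \<le> \<gamma> * log 2 (real (num_linear_extensions r A))"
    using prod_wt_le_num_linear_extensions wt_pos \<gamma>_bounds(1)
    by (intro mult_left_mono log_mono prod_pos) auto
  also have "(1 - \<gamma> / 2) * real (card I) \<le> (1 - \<gamma> / 2) * real (2 * kappa2 A r)"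
    using card_isolated_edges_le \<gamma>_bounds(2)
    unfolding I_def by (intro mult_left_mono of_nat_mono) auto
  finally show ?thesis by (simp add: algebra_simps)
qed

end

lemma optimal_interval_layout:
  assumes "finite A" "partial_order_on A r" "\<And>S. antichain A r S \<Longrightarrow> card S \<le> 2"
  obtains x s where "interval_layout A r x s (real (card A))"
proof -
  interpret finite_poset A r using assms(1,2) by unfold_locales
  obtain x u :: "_ \<Rightarrow> real" where x: "x \<in> STAB A (incomparability A r)" "\<And>v. v \<in> A \<Longrightarrow> 0 < x v"
    "\<And>v. x v = (\<Sum>S | chain S. u S * indicator S v)" and u: "sum u {S. chain S} = 1"
    and chain_le: "\<And>S. chain S \<Longrightarrow> (\<Sum>v\<in>S. 1 / x v) \<le> real (card A)"
    and tight: "\<And>S. chain S \<Longrightarrow> u S \<noteq> 0 \<Longrightarrow> (\<Sum>v\<in>S. 1 / x v) = real (card A)"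
    using optimal_STAB_decomposition[OF finite_simple_graph_incomparability[OF assms(1)]] by blast
  interpret weighted_chains A r "\<lambda>v. 1 / x v" "real (card A)"
    using chain_le by unfold_locales
  have "(\<Sum>v | v \<in> A \<and> start v \<le> \<tau> \<and> \<tau> < start v + 1 / x v. x v) = 1"
    if \<tau>: "0 \<le> \<tau>" "\<tau> < real (card A)" for \<tau>
  proof -
    define P where "P v = (if start v \<le> \<tau> \<and> \<tau> < start v + 1 / x v then 1 else 0 :: real)" for v
    have "sum P S = 1" if S: "chain S" "u S \<noteq> 0" for S
    proof -
      obtain v where "{v \<in> S. start v \<le> \<tau> \<and> \<tau> < start v + 1 / x v} = {v}"
        using tight_chain_covers_once[OF S(1) tight[OF S] \<tau>] by blast
      then show ?thesis
        using finite_chain[OF S(1)] by (simp add: P_def sum.If_cases Int_def)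
    qed
    then have "(\<Sum>S | chain S. u S * sum P S) = sum u {S. chain S}" by (intro sum.cong) auto
    then have "(\<Sum>v\<in>A. x v * P v) = 1"
      using sum_stable_set_weights[OF finite_A x(3)] u by simp
    then show ?thesis
      using finite_A by (simp add: P_def if_distrib sum.If_cases Int_def cong: if_cong)
  qed
  then have "interval_layout A r x start (real (card A))"
    using assms(3) x(2) STAB_edge_le_1[OF x(1)] start_nonneg end_le_L end_le_start
    by unfold_locales auto
  then show thesis by (rule that)
qed

lemma antichain_card_le_width:
  assumes "finite A" "antichain A r S"
  shows "card S \<le> width A r"
  unfolding width_def using finite_antichains[OF assms(1)] assms(2) by (intro Max_ge) auto

theorem theorem3:
  fixes A :: "'a set" and r :: "'a rel" and \<epsilon> :: real
  assumes "finite A"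
    and "partial_order_on A r"
    and "width A r = 2"
    and "\<epsilon> = 2 - (3 * log 2 3 - 2) / log 2 3"
  shows "real (card A) * incomparability_entropy A r
    \<le> (2 - \<epsilon>) * log 2 (real (card (linear_extensions A r))) + \<epsilon> * real (kappa2 A r)"
proof -
  have "card S \<le> 2" if "antichain A r S" for S
    using antichain_card_le_width[OF assms(1) that] assms(3) by simp
  then obtain x s where "interval_layout A r x s (real (card A))"
    by (rule optimal_interval_layout[OF assms(1,2)])
  then interpret interval_layout A r x s "real (card A)" .
  have "Restr r A = r" using partial_order_onD(4)[OF assms(2)] by blast
  then have "num_linear_extensions r A = card (linear_extensions A r)"
    by (simp add: num_linear_extensions_def)
  moreover have "\<epsilon> = 2 - \<gamma>" by (simp add: assms(4) \<gamma>_def)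
  ultimately show ?thesis
    using order_trans[OF entropy_le_sum_log_round_unit sum_log_round_unit_le] by simp
qed

end
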